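(* Let $\lambda$ be a partition with at most $n$ parts and $m$ a positive integer. The dilatation map $\theta_m$ and the Baker embedding $E$ commute on $\mathsf{KN}(\lambda,n)$: as maps $\mathsf{KN}(\lambda,n)\to\mathsf{SSYT}(m\lambda^A,2n)$ one has $\theta_mE=E\theta_m$, where on the left-hand side $E:\mathsf{KN}(\lambda,n)\hookrightarrow\mathsf{SSYT}(\lambda^A,2n)$ and $\theta_m:\mathsf{SSYT}(\lambda^A,2n)\hookrightarrow\mathsf{SSYT}(m\lambda^A,2n)$, and on the right-hand side $\theta_m:\mathsf{KN}(\lambda,n)\hookrightarrow\mathsf{KN}(m\lambda,n)$ and $E:\mathsf{KN}(m\lambda,n)\hookrightarrow\mathsf{SSYT}(m\lambda^A,2n)$.
   Context: **Type $C_n$.** The alphabet is $[\pm n]=\{1<\dots<n<\overline n<\dots<\overline1\}$, $\overline i=-i$. A column (strictly increasing from top to bottom) $C$ is admissible if, with $I=\{z_1>\dots>z_r\}$ the set of unbarred $z$ with $z,\overline z\in C$, there are $t_1>\dots>t_r$ in $[n]$ such that $t_1$ is the greatest letter of $[n]$ with $t_1<z_1$, $t_1,\overline{t_1}\notin C$, and for $i\ge2$, $t_i$ is the greatest with $t_i<\min(t_{i-1},z_i)$, $t_i,\overline{t_i}\notin C$; then $rC$ (resp. $\ell C$) is obtained by replacing each $\overline{z_i}$ by $\overline{t_i}$ (resp. each $z_i$ by $t_i$) and reordering. $\mathsf{KN}(\lambda,n)$ is the set of semistandard tableaux of shape $\lambda$ on $[\pm n]$ with admissible columns $C_1,\dots,C_k$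 such that the tableau with columns $\ell C_1,rC_1,\dots,\ell C_k,rC_k$ is semistandard. Crystal operators $f_i$, $i\in[n]$: read columns right to left, each top to bottom; mark letters $i,\overline{i+1}$ by $+$ and $i+1,\overline i$ by $-$ (for $i=n$: $n$ by $+$, $\overline n$ by $-$), successively cancel pairs $+-$ to leave $-^a+^b$; $f_i$ changes the letter of the leftmost remaining $+$ ($i\mapsto i+1$, $\overline{i+1}\mapsto\overline i$; $n\mapsto\overline n$ when $i=n$), and $f_i=0$ if $b=0$. $K(\lambda)$ (row $i$ filled with $i$) is the highest weight element and generates $\mathsf{KN}(\lambda,n)$ under the $f_i$. **Type $A_{2n-1}$.** $\mathsf{SSYT}(\mu,2n)$ is the crystal of semistandard tableaux of shape $\mu$ on $[2n]$ with operators $f_i^A$, $1\le i\le2n-1$, given by the same rule with $i\mapsto+$, $i+1\mapsto-$, and highest weight element $K(\mu)$ (row $i$ filled with $i$). **Baker embedding.** For $\lambda=\Lambda_{m_1}+\cdots+\Lambda_{m_k}$ ($1\le m_1\le\dots\le m_k\le n$, $\Lambda_j=\mathbf e_1+\dots+\mathbf e_j\in\mathbb Z^n$), put $\lambda^A=\sum_{i=1}^k(\Lambda^A_{m_i}+\Lambda^A_{2n-m_i})\in\mathbb Z^{2n}$, $\Lambda^A_j=\mathbf e_1+\dots+\mathbf e_j\in\mathbb Z^{2n}$; note $(m\lambda)^A=m\lambda^A$. Let $f_i^E=f_i^Af_{2n-i}^A=f_{2n-i}^Af_i^A$ for $i<n$ and $f_n^E=(f_n^A)^2$. $E:\mathsf{KN}(\lambda,n)\hookrightarrow\mathsf{SSYT}(\lambda^A,2n)$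 is the injection with $E(f_{i_1}\cdots f_{i_l}K(\lambda))=f^E_{i_1}\cdots f^E_{i_l}K(\lambda^A)$. **Dilatation.** In either type, with $\mathfrak B(\mu)$ denoting the crystal ($\mathsf{KN}(\mu,n)$ or $\mathsf{SSYT}(\mu,2n)$) with highest weight element $K(\mu)$, $\theta_m:\mathfrak B(\mu)\hookrightarrow\mathfrak B(m\mu)$ is the unique injection such that $\theta_m(f_{i_1}\cdots f_{i_l}K(\mu))=f_{i_1}^m\cdots f_{i_l}^mK(m\mu)$ for every path $f_{i_1}\cdots f_{i_l}K(\mu)\neq 0$ (with $f_i^A$ in place of $f_i$ in type $A$). *)

theory Defs
  imports Main "HOL-Library.FuncSet"
begin

section \<open>The alphabet of type $C$\<close>

datatype cletter = Unb nat | Bar nat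

instantiation cletter :: linorder
begin

fun less_eq_cletter :: "cletter \<Rightarrow> cletter \<Rightarrow> bool" where
  "Unb i \<le> Unb j \<longleftrightarrow> i \<le> j"
| "Unb i \<le> Bar j \<longleftrightarrow> True"
| "Bar i \<le> Unb j \<longleftrightarrow> False"
| "Bar i \<le> Bar j \<longleftrightarrow> j \<le> i"

definition less_cletter :: "cletter \<Rightarrow> cletter \<Rightarrow> bool" where
  "less_cletter x y \<longleftrightarrow> x \<le> y \<and> \<not> y \<le> x"

instance
proof
  fix x y z :: cletter
  show "x < y \<longleftrightarrow> x \<le> y \<and> \<not> y \<le> x" by (rule less_cletter_def)
  show "x \<le> x" by (cases x) auto
  show "x \<le> y \<Longrightarrow> y \<le> z \<Longrightarrow> x \<le> z" by (cases x; cases y; cases z) auto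
  show "x \<le> y \<Longrightarrow> y \<le> x \<Longrightarrow> x = y" by (cases x; cases y) auto
  show "x \<le> y \<or> y \<le> x" by (cases x; cases y) auto
qed

end

definition calphabet :: "nat \<Rightarrow> cletter set" where
  "calphabet n = Unb ` {1..n} \<union> Bar ` {1..n}"

section \<open>Partitions and tableaux\<close>

text \<open>A partition with at most N parts is a weakly decreasing list of length N, padded with zeros.\<close>

definition is_partition :: "nat \<Rightarrow> nat list \<Rightarrow> bool" where
  "is_partition N \<mu> \<longleftrightarrow> length \<mu> = N \<and> sorted_wrt (\<ge>) \<mu>"

definition scale_partition :: "nat \<Rightarrow> nat list \<Rightarrow> nat list" where
  "scale_partition m \<mu> = map (\<lambda>p. m * p) \<mu>"

definition col_heights :: "nat list \<Rightarrow> nat list" where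
  "col_heights \<mu> = map (\<lambda>j. length (filter (\<lambda>p. j < p) \<mu>)) [0..<Max (insert 0 (set \<mu>))]"

text \<open>A tableau is the list of its columns from left to right, each read from top to bottom.\<close>

type_synonym 'a tableau = "'a list list"

definition has_shape :: "nat list \<Rightarrow> 'a tableau \<Rightarrow> bool" where
  "has_shape \<mu> T \<longleftrightarrow> map length T = col_heights \<mu>"

definition semistandard :: "'a::linorder tableau \<Rightarrow> bool" where
  "semistandard T \<longleftrightarrow>
     (\<forall>C\<in>set T. sorted_wrt (<) C) \<and>
     (\<forall>j. Suc j < length T \<longrightarrow>
        length (T ! Suc j) \<le> length (T ! j) \<and>
        (\<forall>r < length (T ! Suc j). T ! j ! r \<le> T ! Suc j ! r))"

section \<open>Kashiwara-Nakashima tableaux\<close>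

text \<open>The letters $z_1 > \dots > z_r$ of a column.\<close>

definition doubled :: "cletter list \<Rightarrow> nat list" where
  "doubled C = rev (sorted_list_of_set {z. Unb z \<in> set C \<and> Bar z \<in> set C})"

definition split_candidates :: "cletter list \<Rightarrow> nat list \<Rightarrow> nat \<Rightarrow> nat set" where
  "split_candidates C ts i =
     {t. 1 \<le> t \<and> t < doubled C ! i \<and> (0 < i \<longrightarrow> t < ts ! (i - 1)) \<and>
         Unb t \<notin> set C \<and> Bar t \<notin> set C}"

text \<open>The list ts is the sequence $t_1 > \dots > t_r$ attached to C. For a column on the letters
  of rank n, the bound $t_i \le n$ is implied by $t_i < z_i$.\<close>

definition split_letters :: "cletter list \<Rightarrow> nat list \<Rightarrow> bool" where
  "split_letters C ts \<longleftrightarrow>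
     length ts = length (doubled C) \<and>
     (\<forall>i < length ts. ts ! i \<in> split_candidates C ts i \<and>
                      (\<forall>t \<in> split_candidates C ts i. t \<le> ts ! i))"

definition admissible :: "cletter list \<Rightarrow> bool" where
  "admissible C \<longleftrightarrow> (\<exists>ts. split_letters C ts)"

definition the_split_letters :: "cletter list \<Rightarrow> nat list" where
  "the_split_letters C = (THE ts. split_letters C ts)"

definition right_col :: "cletter list \<Rightarrow> cletter list" where
  "right_col C = sorted_list_of_set
     ((set C - Bar ` set (doubled C)) \<union> Bar ` set (the_split_letters C))"

definition left_col :: "cletter list \<Rightarrow> cletter list" where
  "left_col C = sorted_list_of_set
     ((set C - Unb ` set (doubled C)) \<union> Unb ` set (the_split_letters C))"

definition split_tableau :: "cletter tableau \<Rightarrow> cletter tableau" where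
  "split_tableau T = concat (map (\<lambda>C. [left_col C, right_col C]) T)"

definition KN :: "nat \<Rightarrow> nat list \<Rightarrow> cletter tableau set" where
  "KN n \<mu> = {T. has_shape \<mu> T \<and> semistandard T \<and>
     (\<forall>C\<in>set T. set C \<subseteq> calphabet n \<and> admissible C) \<and>
     semistandard (split_tableau T)}"

definition SSYT :: "nat \<Rightarrow> nat list \<Rightarrow> nat tableau set" where
  "SSYT N \<mu> = {T. has_shape \<mu> T \<and> semistandard T \<and> (\<forall>C\<in>set T. set C \<subseteq> {1..N})}"

text \<open>The highest weight elements: row r is filled with r.\<close>

definition K_A :: "nat list \<Rightarrow> nat tableau" where
  "K_A \<mu> = map (\<lambda>h. [1..<Suc h]) (col_heights \<mu>)"

definition K_C :: "nat list \<Rightarrow> cletter tableau" where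
  "K_C \<mu> = map (map Unb) (K_A \<mu>)"

section \<open>Crystal operators\<close>

datatype sign = Plus | Minus

text \<open>Cells (column, row), counted from 0, columns from right to left, each from top to bottom.\<close>

definition reading_cells :: "'a tableau \<Rightarrow> (nat \<times> nat) list" where
  "reading_cells T =
     concat (map (\<lambda>j. map (\<lambda>r. (j, r)) [0..<length (T ! j)]) (rev [0..<length T]))"

definition marked_cells ::
  "('a \<Rightarrow> sign option) \<Rightarrow> 'a tableau \<Rightarrow> (sign \<times> nat \<times> nat) list" where
  "marked_cells mark T =
     List.map_filter (\<lambda>(j, r). map_option (\<lambda>s. (s, j, r)) (mark (T ! j ! r))) (reading_cells T)"

text \<open>Successive cancellation of adjacent pairs Plus Minus. The tail is reduced first, hence of
  the form $-^a +^b$, and a Plus put in front of it cancels with its first sign if $a > 0$.\<close>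

fun cancel :: "(sign \<times> 'p) list \<Rightarrow> (sign \<times> 'p) list" where
  "cancel [] = []"
| "cancel (x # xs) =
     (case cancel xs of
        [] \<Rightarrow> [x]
      | y # ys \<Rightarrow> if fst x = Plus \<and> fst y = Minus then ys else x # y # ys)"

text \<open>The value None stands for the 0 of the crystal; move is only applied to letters marked Plus.\<close>

definition crystal_op ::
  "('a \<Rightarrow> sign option) \<Rightarrow> ('a \<Rightarrow> 'a) \<Rightarrow> 'a tableau \<Rightarrow> 'a tableau option" where
  "crystal_op mark move T =
     (case filter (\<lambda>x. fst x = Plus) (cancel (marked_cells mark T)) of
        [] \<Rightarrow> None
      | (_, j, r) # _ \<Rightarrow> Some (T[j := (T ! j)[r := move (T ! j ! r)]]))"

definition mark_C :: "nat \<Rightarrow> nat \<Rightarrow> cletter \<Rightarrow> sign option" where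
  "mark_C n i x =
     (if x = Unb i \<or> (i < n \<and> x = Bar (Suc i)) then Some Plus
      else if x = Bar i \<or> (i < n \<and> x = Unb (Suc i)) then Some Minus
      else None)"

definition move_C :: "nat \<Rightarrow> nat \<Rightarrow> cletter \<Rightarrow> cletter" where
  "move_C n i x = (if x = Unb i then (if i < n then Unb (Suc i) else Bar n) else Bar i)"

definition f_C :: "nat \<Rightarrow> nat \<Rightarrow> cletter tableau \<Rightarrow> cletter tableau option" where
  "f_C n i = crystal_op (mark_C n i) (move_C n i)"

definition mark_A :: "nat \<Rightarrow> nat \<Rightarrow> sign option" where
  "mark_A i x = (if x = i then Some Plus else if x = Suc i then Some Minus else None)"

definition f_A :: "nat \<Rightarrow> nat tableau \<Rightarrow> nat tableau option" where
  "f_A i = crystal_op (mark_A i) Suc"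

text \<open>The operator of index i composed m times.\<close>

definition op_power ::
  "('i \<Rightarrow> 'b \<Rightarrow> 'b option) \<Rightarrow> nat \<Rightarrow> 'i \<Rightarrow> 'b \<Rightarrow> 'b option" where
  "op_power f m i x = ((\<lambda>y. Option.bind y (f i)) ^^ m) (Some x)"

text \<open>For ps = $[i_1, \dots, i_l]$ this is $f_{i_1} \cdots f_{i_l} x$, the last index acting first.\<close>

definition apply_path :: "('i \<Rightarrow> 'b \<Rightarrow> 'b option) \<Rightarrow> 'i list \<Rightarrow> 'b \<Rightarrow> 'b option" where
  "apply_path f ps x = foldr (\<lambda>i y. Option.bind y (f i)) ps (Some x)"

section \<open>Baker embedding and dilatation\<close>

text \<open>The columns of \<open>\<mu>\<close> have heights $m_1, \dots, m_k$; a column of height h contributes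
  $\Lambda^A_h + \Lambda^A_{2n-h}$. Coordinates r are counted from 0.\<close>

definition shape_A :: "nat \<Rightarrow> nat list \<Rightarrow> nat list" where
  "shape_A n \<mu> =
     map (\<lambda>r. \<Sum>h\<leftarrow>col_heights \<mu>. of_bool (r < h) + of_bool (r < 2 * n - h)) [0..<2 * n]"

text \<open>For $i < n$ the two operators commute.\<close>

definition f_E :: "nat \<Rightarrow> nat \<Rightarrow> nat tableau \<Rightarrow> nat tableau option" where
  "f_E n i T =
     (if i < n then Option.bind (f_A (2 * n - i) T) (f_A i)
      else Option.bind (f_A n T) (f_A n))"

text \<open>E is the Baker embedding on \<open>KN(\<mu>, n)\<close>. The path condition includes that the path on
  the right-hand side does not vanish; as every element of \<open>KN(\<mu>, n)\<close> is reached by a path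
  from the highest weight element, it determines E on \<open>KN(\<mu>, n)\<close>.\<close>

definition is_baker_embedding ::
  "nat \<Rightarrow> nat list \<Rightarrow> (cletter tableau \<Rightarrow> nat tableau) \<Rightarrow> bool" where
  "is_baker_embedding n \<mu> E \<longleftrightarrow>
     E \<in> KN n \<mu> \<rightarrow> SSYT (2 * n) (shape_A n \<mu>) \<and> inj_on E (KN n \<mu>) \<and>
     (\<forall>ps T. set ps \<subseteq> {1..n} \<longrightarrow> apply_path (f_C n) ps (K_C \<mu>) = Some T \<longrightarrow>
        apply_path (f_E n) ps (K_A (shape_A n \<mu>)) = Some (E T))"

text \<open>\<open>\<theta>\<close> is the m-dilatation \<open>B(\<mu>) \<rightarrow> B(m\<mu>)\<close> of a family B of crystals with index set I,
  operators f and highest weight elements K.\<close>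

definition is_dilatation ::
  "'i set \<Rightarrow> ('i \<Rightarrow> 'b \<Rightarrow> 'b option) \<Rightarrow> (nat list \<Rightarrow> 'b set) \<Rightarrow> (nat list \<Rightarrow> 'b) \<Rightarrow>
   nat \<Rightarrow> nat list \<Rightarrow> ('b \<Rightarrow> 'b) \<Rightarrow> bool" where
  "is_dilatation I f B K m \<mu> \<theta> \<longleftrightarrow>
     \<theta> \<in> B \<mu> \<rightarrow> B (scale_partition m \<mu>) \<and> inj_on \<theta> (B \<mu>) \<and>
     (\<forall>ps T. set ps \<subseteq> I \<longrightarrow> apply_path f ps (K \<mu>) = Some T \<longrightarrow>
        apply_path (op_power f m) ps (K (scale_partition m \<mu>)) = Some (\<theta> T))"

definition is_dilatation_C ::
  "nat \<Rightarrow> nat \<Rightarrow> nat list \<Rightarrow> (cletter tableau \<Rightarrow> cletter tableau) \<Rightarrow> bool" where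
  "is_dilatation_C n = is_dilatation {1..n} (f_C n) (KN n) K_C"

definition is_dilatation_A ::
  "nat \<Rightarrow> nat \<Rightarrow> nat list \<Rightarrow> (nat tableau \<Rightarrow> nat tableau) \<Rightarrow> bool" where
  "is_dilatation_A n = is_dilatation {1..<2 * n} f_A (SSYT (2 * n)) K_A"

end

theory Submission
  imports Defs
begin

text \<open>
  Along a path from the highest weight element both sides of the identity are computed by the same
  word in the type A operators, because $f_i^A$ and $f_{2n-i}^A$ commute for $i < n$. What remains is
  that every tableau T in \<open>KN(\<mu>, n)\<close> lies on such a path.

  For a column C let $u(k)$ and $b(k)$ be the numbers of letters $x$ and $\bar x$ in C with
  $x \<le> k$, and $s(k) = u(k) + b(k) - k$. Then C is admissible iff $s \<le> 0$, and
  passing to $\ell C$ (resp. $rC$) adds the maximum of $s(j) - s(k)$ over $j \<ge> k$ to $u(k)$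
  (resp. to $b(k)$). As two columns are comparable iff their counting functions are, membership in
  \<open>KN(\<mu>, n)\<close> becomes a system of linear inequalities between adjacent columns. It
  is preserved when the rightmost uncancelled Minus of T is raised, i.e. by the inverse of $f_i$, and
  only the highest weight element has no uncancelled Minus for any i.
\<close>

section \<open>Signatures\<close>

text \<open>The maps are prescribed only by their values along paths, whereas \<open>KN\<close> is
  defined through columns and their split forms, so a path has to be constructed for each tableau.
  The obstacle is that the letters t_i are chosen greedily: moving one letter of a column can change
  the whole list. Unfolding the maximum into one inequality for each pair k \<le> j removes it. For
  i < n, raising a letter alters one of the two counts, and only at k = i, so the altered
  inequalities can be deduced from old ones at i - 1, i and i + 1. For i = n the slack does not
  change at all. Against the left neighbour one unit is missing at first; it comes from the choice
  of the rightmost uncancelled Minus, which restricts the letters with indices i and i + 1 in that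
  neighbour. The process stops because each step lowers the sum of the positions of the letters in
  the alphabet.\<close>

fun eps :: "sign list \<Rightarrow> nat" where
  "eps [] = 0"
| "eps (Plus # xs) = eps xs - 1"
| "eps (Minus # xs) = Suc (eps xs)"

text \<open>\<open>eps\<close> and \<open>phi\<close> are the exponents a and b of the reduced word
  -^a +^b. The truncated subtraction in \<open>eps\<close> covers a Plus that finds no Minus to its
  right; \<open>phi\<close> then counts it.\<close>

fun phi :: "sign list \<Rightarrow> nat" where
  "phi [] = 0"
| "phi (Plus # xs) = (if eps xs = 0 then Suc (phi xs) else phi xs)"
| "phi (Minus # xs) = phi xs"

text \<open>The Plus signs surviving in the first word meet the Minus signs surviving in the second;
  the truncated difference is what they fail to cancel.\<close>

lemma eps_append: "eps (xs @ ys) = eps xs + (eps ys - phi xs)"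
  by (induction xs rule: eps.induct) auto

lemma phi_append: "phi (xs @ ys) = phi ys + (phi xs - eps ys)"
  by (induction xs rule: eps.induct) (auto simp: eps_append)

text \<open>Both facts come from the normal form of \<open>cancel\<close>: as many Minus entries as
  \<open>eps\<close> says, followed by Plus entries. They link the sign words, which forget the
  cells, to \<open>cancel\<close>, which keeps them.\<close>

lemma cancel_head_Minus:
  "eps (map fst w) > 0 \<Longrightarrow> \<exists>c ys. cancel w = (Minus, c) # ys"
  and cancel_no_Minus: "eps (map fst w) = 0 \<Longrightarrow> \<forall>x\<in>set (cancel w). fst x = Plus"
proof -
  have *: "(\<exists>ms ps. cancel w = ms @ ps \<and> (\<forall>x\<in>set ms. fst x = Minus) \<and>
      (\<forall>x\<in>set ps. fst x = Plus) \<and> length ms = eps (map fst w))"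
  proof (induction w)
    case Nil
    then show ?case by auto
  next
    case (Cons x w)
    then obtain ms ps where IH: "cancel w = ms @ ps" "\<forall>x\<in>set ms. fst x = Minus"
      "\<forall>x\<in>set ps. fst x = Plus" "length ms = eps (map fst w)" by blast
    obtain s c where x: "x = (s, c)" by (cases x)
    show ?case
    proof (cases s)
      case Plus
      show ?thesis
      proof (cases ms)
        case Nil
        then show ?thesis using IH x Plus
          by (intro exI[of _ "[]"] exI[of _ "x # ps"]) (auto split: list.split)
      next
        case (Cons y ms')
        then show ?thesis using IH x Plus
          by (intro exI[of _ ms'] exI[of _ ps]) (auto simp flip: IH(4))
      qed
    next
      case Minus
      then show ?thesis using IH x
        by (intro exI[of _ "x # ms"] exI[of _ ps]) (auto split: list.split)
    qed
  qed
  then obtain ms ps where IH: "cancel w = ms @ ps" "\<forall>x\<in>set ms. fst x = Minus"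
      "\<forall>x\<in>set ps. fst x = Plus" "length ms = eps (map fst w)" by blast
  show "eps (map fst w) > 0 \<Longrightarrow> \<exists>c ys. cancel w = (Minus, c) # ys"
    using IH by (cases ms) (force simp: prod_eq_iff)+
  show "eps (map fst w) = 0 \<Longrightarrow> \<forall>x\<in>set (cancel w). fst x = Plus"
    using IH by auto
qed

text \<open>A Plus of \<open>u\<close> finds its Minus within \<open>u\<close>, so it cannot
  survive, and a Minus put in front cancels nothing.\<close>

lemma filter_cancel_append:
  assumes "phi (map fst u) = 0" "eps (map fst w) = 0"
  shows "filter (\<lambda>x. fst x = Plus) (cancel (u @ w)) = filter (\<lambda>x. fst x = Plus) (cancel w)"
  using assms(1)
proof (induction u)
  case (Cons x u)
  obtain s c where x: "x = (s, c)" by (cases x)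
  show ?case
  proof (cases s)
    case Plus
    then have "eps (map fst u) > 0" "phi (map fst u) = 0"
      using Cons.prems x by (auto split: if_splits)
    moreover from this have "eps (map fst (u @ w)) > 0"
      by (simp add: eps_append)
    ultimately show ?thesis
      using Cons.IH x Plus cancel_head_Minus[of "u @ w"] by auto
  next
    case Minus
    then show ?thesis using Cons x by (auto split: list.split)
  qed
qed auto

text \<open>Counterpart of \<open>last_Minus\<close>: once the rightmost surviving Minus is turned
  into a Plus, the same conditions on both sides make it the leftmost surviving Plus, which is where
  the crystal operator acts.\<close>

lemma filter_cancel_first:
  assumes "phi (map fst u) = 0" "eps (map fst v) = 0"
  shows "\<exists>ys. filter (\<lambda>x. fst x = Plus) (cancel (u @ (Plus, c) # v)) = (Plus, c) # ys"
proof -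
  have "cancel ((Plus, c) # v) = (Plus, c) # cancel v"
    using cancel_no_Minus[OF assms(2)] by (auto split: list.split)
  then show ?thesis
    using filter_cancel_append[of u "(Plus, c) # v"] assms by auto
qed

lemma last_Minus:
  "eps w > 0 \<Longrightarrow> \<exists>u v. w = u @ Minus # v \<and> phi u = 0 \<and> eps v = 0"
proof (induction w rule: eps.induct)
  case (2 xs)
  then have "eps xs > 0" by auto
  then obtain u v where uv: "xs = u @ Minus # v" "phi u = 0" "eps v = 0"
    using 2 by auto
  \<comment> \<open>At least two Minus signs survive in \<open>xs\<close>, and the chosen one
    accounts for only one of them; so \<open>u\<close> keeps one that absorbs the Plus in
    front.\<close>
  then have "eps u > 0" using 2 by (auto simp: eps_append)
  then show ?case using uv
    by (intro exI[of _ "Plus # u"] exI[of _ v]) auto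
next
  case (3 xs)
  show ?case
  proof (cases "eps xs = 0")
    case True
    then show ?thesis by (intro exI[of _ "[]"] exI[of _ xs]) auto
  next
    case False
    then obtain u v where "xs = u @ Minus # v" "phi u = 0" "eps v = 0"
      using 3 by auto
    then show ?thesis by (intro exI[of _ "Minus # u"] exI[of _ v]) auto
  qed
qed auto

section \<open>From sign words back to the cells of a tableau\<close>

lemma map_filter_append: "List.map_filter f (xs @ ys) = List.map_filter f xs @ List.map_filter f ys"
  by (simp add: List.map_filter_def)

lemma map_filter_split:
  "List.map_filter f xs = u @ y # v \<Longrightarrow>
   \<exists>U x V. xs = U @ x # V \<and> f x = Some y \<and> List.map_filter f U = u \<and> List.map_filter f V = v"
proof (induction xs arbitrary: u)
  case Nil
  then show ?case by simp
next
  case (Cons a xs)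
  show ?case
  proof (cases "f a")
    case None
    then have "List.map_filter f xs = u @ y # v" using Cons.prems by simp
    then obtain U x V where "xs = U @ x # V" "f x = Some y" "List.map_filter f U = u"
      "List.map_filter f V = v" using Cons.IH by blast
    then show ?thesis using None
      by (intro exI[of _ "a # U"] exI[of _ x] exI[of _ V]) auto
  next
    case (Some b)
    then have eq: "b # List.map_filter f xs = u @ y # v"
      using Cons.prems by simp
    show ?thesis
    proof (cases u)
      case Nil
      then show ?thesis using eq Some
        by (intro exI[of _ "[]"] exI[of _ a] exI[of _ xs]) auto
    next
      case (Cons b' u')
      then have "List.map_filter f xs = u' @ y # v" "b' = b" using eq by auto
      then obtain U x V where "xs = U @ x # V" "f x = Some y" "List.map_filter f U = u'"
        "List.map_filter f V = v" using Cons.IH by blast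
      then show ?thesis using Some Cons \<open>b' = b\<close>
        by (intro exI[of _ "a # U"] exI[of _ x] exI[of _ V]) auto
    qed
  qed
qed

lemma concat_split:
  "concat xss = U @ x # V \<Longrightarrow>
   \<exists>yss u v zss. xss = yss @ (u @ x # v) # zss \<and> U = concat yss @ u \<and> V = v @ concat zss"
proof (induction xss arbitrary: U)
  case (Cons xs xss)
  then have "xs @ concat xss = U @ x # V" by simp
  then consider us where "xs = U @ us" "us @ concat xss = x # V"
    | us where "xs @ us = U" "concat xss = us @ x # V"
    unfolding append_eq_append_conv2 by blast
  then show ?case
  proof cases
    case 1
    show ?thesis
    proof (cases us)
      case Nil
      then have "concat xss = [] @ x # V" using 1 by simp
      from Cons.IH[OF this] obtain yss u v zss where
        "xss = yss @ (u @ x # v) # zss" "[] = concat yss @ u" "V = v @ concat zss" by blast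
      then show ?thesis using 1 Nil
        by (intro exI[of _ "xs # yss"] exI[of _ u] exI[of _ v] exI[of _ zss]) auto
    next
      case (Cons a v)
      then show ?thesis using 1
        by (intro exI[of _ "[]"] exI[of _ U] exI[of _ v] exI[of _ xss]) auto
    qed
  next
    case 2
    from Cons.IH[OF 2(2)] obtain yss u v zss where
        "xss = yss @ (u @ x # v) # zss" "us = concat yss @ u" "V = v @ concat zss" by blast
    then show ?thesis using 2
      by (intro exI[of _ "xs # yss"] exI[of _ u] exI[of _ v] exI[of _ zss]) auto
  qed
qed simp

abbreviation signature :: "('a \<Rightarrow> sign option) \<Rightarrow> 'a tableau \<Rightarrow> sign list" where
  "signature mark T \<equiv> List.map_filter mark (concat (rev T))"

text \<open>The rightmost surviving Minus is pulled back through marking and concatenation to its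
  column, with \<open>u\<close> above it and \<open>v\<close> below. As columns are read from right
  to left, \<open>post\<close> is read before \<open>u\<close> and \<open>pre\<close> after
  \<open>v\<close>.\<close>

lemma signature_split:
  assumes "eps (signature mark T) > 0"
  obtains pre u x v post where "T = pre @ (u @ x # v) # post" "mark x = Some Minus"
    "phi (List.map_filter mark (concat (rev post) @ u)) = 0"
    "eps (List.map_filter mark (v @ concat (rev pre))) = 0"
proof -
  obtain u v where uv: "signature mark T = u @ Minus # v" "phi u = 0" "eps v = 0"
    using last_Minus[OF assms] by blast
  obtain U x V where UV: "concat (rev T) = U @ x # V" "mark x = Some Minus"
    "List.map_filter mark U = u" "List.map_filter mark V = v"
    using map_filter_split[OF uv(1)] by blast
  obtain yss u' v' zss where *: "rev T = yss @ (u' @ x # v') # zss" "U = concat yss @ u'"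
    "V = v' @ concat zss"
    using concat_split[OF UV(1)] by blast
  have "T = rev zss @ (u' @ x # v') # rev yss"
    using arg_cong[OF *(1), of rev] by simp
  then show ?thesis
    by (rule that) (use * UV uv in auto)
qed

lemma map_fst_column_cells:
  "map fst (List.map_filter (\<lambda>(j, r). map_option (\<lambda>s. (s, j, r)) (mark (T ! j ! r)))
     (map (\<lambda>r. (j, r)) rs)) = List.map_filter mark (map ((!) (T ! j)) rs)"
  by (induction rs) (auto split: option.split)

lemma map_fst_cells:
  "map fst (List.map_filter (\<lambda>(j, r). map_option (\<lambda>s. (s, j, r)) (mark (T ! j ! r)))
     (concat (map (\<lambda>j. map (\<lambda>r. (j, r)) [0..<length (T ! j)]) js))) =
   List.map_filter mark (concat (map ((!) T) js))"
  by (induction js)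
    (auto simp: map_filter_append map_fst_column_cells map_nth)

lemma upt_split: "k < n \<Longrightarrow> [0..<n] = [0..<k] @ k # [Suc k..<n]"
  using upt_add_eq_append[of 0 k "n - k"] by (simp add: upt_conv_Cons)

lemma marked_cells_split:
  assumes "mark y = Some s"
  obtains A B where
    "marked_cells mark (pre @ (u @ y # v) # post) = A @ (s, length pre, length u) # B"
    "map fst A = List.map_filter mark (concat (rev post) @ u)"
    "map fst B = List.map_filter mark (v @ concat (rev pre))"
proof -
  define T where "T = pre @ (u @ y # v) # post"
  define k where "k = length pre"
  define cell where "cell = (\<lambda>(j, r). map_option (\<lambda>s. (s, j, r)) (mark (T ! j ! r)))"
  define cols where "cols = (\<lambda>js. concat (map (\<lambda>j. map (\<lambda>r. (j, r)) [0..<length (T ! j)]) js))"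
  have len: "length T = Suc (k + length post)" by (simp add: T_def k_def)
  have "[0..<length T] = [0..<k] @ k # [Suc k..<length T]"
    by (rule upt_split) (simp add: len)
  then have cells: "reading_cells T =
      cols (rev [Suc k..<length T]) @ map (\<lambda>r. (k, r)) [0..<length (T ! k)] @ cols (rev [0..<k])"
    unfolding reading_cells_def cols_def by simp
  have Tk: "T ! k = u @ y # v" by (simp add: T_def k_def)
  have row: "[0..<length (T ! k)] =
      [0..<length u] @ length u # [Suc (length u)..<length (T ! k)]"
    unfolding Tk
    by (rule upt_split) simp
  define A where "A = List.map_filter cell (cols (rev [Suc k..<length T])) @
     List.map_filter cell (map (\<lambda>r. (k, r)) [0..<length u])"
  define B where
    "B = List.map_filter cell (map (\<lambda>r. (k, r)) [Suc (length u)..<length (T ! k)]) @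
     List.map_filter cell (cols (rev [0..<k]))"
  have "marked_cells mark T = A @ (s, k, length u) # B"
    unfolding marked_cells_def cells row cell_def[symmetric]
    using assms Tk by (simp add: map_filter_append cell_def A_def B_def)
  moreover have "map ((!) T) (rev [Suc k..<length T]) = rev post"
    unfolding rev_map[symmetric]
    by (rule arg_cong[of _ _ rev], rule nth_equalityI) (auto simp: T_def k_def nth_append simp del: upt_Suc)
  moreover have "map ((!) T) (rev [0..<k]) = rev pre"
    unfolding rev_map[symmetric]
    by (rule arg_cong[of _ _ rev], rule nth_equalityI) (auto simp: T_def k_def nth_append simp del: upt_Suc)
  moreover have "map ((!) (T ! k)) [0..<length u] = u"
    by (rule nth_equalityI) (auto simp: Tk nth_append simp del: upt_Suc)
  moreover have "map ((!) (T ! k)) [Suc (length u)..<length (T ! k)] = v"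
    by (rule nth_equalityI) (auto simp: Tk nth_append simp del: upt_Suc)
  ultimately show ?thesis
    using that[of A B] unfolding T_def[symmetric] k_def[symmetric]
    by (simp add: A_def B_def cell_def cols_def map_fst_cells map_fst_column_cells map_filter_append)
qed

text \<open>Lowering undoes raising: the cancellation conditions concern only the other letters,
  which are the same in both tableaux, so the cell of y carries the leftmost surviving Plus.\<close>

lemma crystal_op_split:
  assumes "mark y = Some Plus" "move y = x"
    "phi (List.map_filter mark (concat (rev post) @ u)) = 0"
    "eps (List.map_filter mark (v @ concat (rev pre))) = 0"
  shows "crystal_op mark move (pre @ (u @ y # v) # post) = Some (pre @ (u @ x # v) # post)"
proof -
  obtain A B where AB:
    "marked_cells mark (pre @ (u @ y # v) # post) = A @ (Plus, length pre, length u) # B"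
    "map fst A = List.map_filter mark (concat (rev post) @ u)"
    "map fst B = List.map_filter mark (v @ concat (rev pre))"
    using marked_cells_split[where mark = mark and y = y and pre = pre and post = post, OF assms(1)]
    by metis
  then obtain ys where "filter (\<lambda>x. fst x = Plus) (cancel (A @ (Plus, length pre, length u) # B)) =
      (Plus, length pre, length u) # ys"
    using filter_cancel_first[of A B] assms by metis
  then show ?thesis
    using AB assms by (simp add: crystal_op_def)
qed

section \<open>Counting letters\<close>

text \<open>Integer-valued because the argument works with differences of counts, which may be
  negative.\<close>

definition cnt :: "nat set \<Rightarrow> nat \<Rightarrow> int" where
  "cnt A k = (\<Sum>x=1..k. of_bool (x \<in> A))"

lemma cnt_0 [simp]: "cnt A 0 = 0"
  and cnt_Suc [simp]: "cnt A (Suc k) = cnt A k + of_bool (Suc k \<in> A)"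
  by (simp_all add: cnt_def)

lemma cnt_eq_card: "cnt A k = int (card {x \<in> A. 1 \<le> x \<and> x \<le> k})"
proof -
  have "{1..k} \<inter> {x. x \<in> A} = {x \<in> A. 1 \<le> x \<and> x \<le> k}" by auto
  then show ?thesis by (simp add: cnt_def sum_of_bool_eq)
qed

lemma cnt_diff_mono:
  assumes "k \<le> j" "\<And>x. k < x \<Longrightarrow> x \<le> j \<Longrightarrow> x \<in> A \<Longrightarrow> x \<in> B"
  shows "cnt A j - cnt A k \<le> cnt B j - cnt B k"
  using assms
proof (induction j rule: dec_induct)
  case (step i)
  then have "cnt A i - cnt A k \<le> cnt B i - cnt B k" "Suc i \<in> A \<Longrightarrow> Suc i \<in> B" by auto
  then show ?case by auto
qed simp

definition ucount :: "cletter set \<Rightarrow> nat \<Rightarrow> int" where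
  "ucount S = cnt {x. Unb x \<in> S}"

definition bcount :: "cletter set \<Rightarrow> nat \<Rightarrow> int" where
  "bcount S = cnt {x. Bar x \<in> S}"

definition slack :: "cletter set \<Rightarrow> nat \<Rightarrow> int" where
  "slack S k = ucount S k + bcount S k - int k"

lemma count_0 [simp]: "ucount S 0 = 0" "bcount S 0 = 0"
  and count_Suc [simp]: "ucount S (Suc k) = ucount S k + of_bool (Unb (Suc k) \<in> S)"
    "bcount S (Suc k) = bcount S k + of_bool (Bar (Suc k) \<in> S)"
  by (simp_all add: ucount_def bcount_def)

lemma card_le_Unb:
  assumes "S \<subseteq> calphabet n"
  shows "int (card {y \<in> S. y \<le> Unb k}) = ucount S k"
proof -
  have "{y \<in> S. y \<le> Unb k} = Unb ` {x \<in> {x. Unb x \<in> S}. 1 \<le> x \<and> x \<le> k}"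
  proof (intro equalityI subsetI)
    fix y assume "y \<in> {y \<in> S. y \<le> Unb k}"
    then show "y \<in> Unb ` {x \<in> {x. Unb x \<in> S}. 1 \<le> x \<and> x \<le> k}"
      using assms by (cases y) (auto simp: calphabet_def)
  qed auto
  then show ?thesis
    by (simp add: ucount_def cnt_eq_card card_image inj_on_def)
qed

text \<open>Bars reverse the order, so the letters beyond \<open>Bar (Suc k)\<close> are the barred
  ones with index 1 to k; hence the complement and the shift by one.\<close>

lemma card_le_Bar:
  assumes "S \<subseteq> calphabet n"
  shows "int (card {y \<in> S. y \<le> Bar (Suc k)}) = int (card S) - bcount S k"
proof -
  have "finite S" using assms finite_subset by (fastforce simp: calphabet_def)
  have "{y \<in> S. \<not> y \<le> Bar (Suc k)} = Bar ` {x \<in> {x. Bar x \<in> S}. 1 \<le> x \<and> x \<le> k}"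
  proof (intro equalityI subsetI)
    fix y assume "y \<in> {y \<in> S. \<not> y \<le> Bar (Suc k)}"
    then show "y \<in> Bar ` {x \<in> {x. Bar x \<in> S}. 1 \<le> x \<and> x \<le> k}"
      using assms by (cases y) (auto simp: calphabet_def)
  qed auto
  then have "int (card {y \<in> S. \<not> y \<le> Bar (Suc k)}) = bcount S k"
    by (simp add: bcount_def cnt_eq_card card_image inj_on_def)
  moreover have "card S = card {y \<in> S. y \<le> Bar (Suc k)} + card {y \<in> S. \<not> y \<le> Bar (Suc k)}"
    using \<open>finite S\<close> by (subst card_Un_disjoint[symmetric]) (auto intro: arg_cong[of _ _ card])
  ultimately show ?thesis by linarith
qed

lemma card_eq_counts:
  assumes "S \<subseteq> calphabet n"
  shows "int (card S) = ucount S n + bcount S n"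
proof -
  have "finite S" using assms finite_subset by (fastforce simp: calphabet_def)
  \<comment> \<open>\<open>Bar (Suc n)\<close> lies between the unbarred and the barred letters of
    the alphabet without belonging to it.\<close>
  have "{y \<in> S. y \<le> Bar (Suc n)} = {y \<in> S. y \<le> Unb n}"
  proof (intro equalityI subsetI)
    fix y assume "y \<in> {y \<in> S. y \<le> Bar (Suc n)}"
    then show "y \<in> {y \<in> S. y \<le> Unb n}"
      using assms by (cases y) (auto simp: calphabet_def)
  next
    fix y assume "y \<in> {y \<in> S. y \<le> Unb n}"
    then show "y \<in> {y \<in> S. y \<le> Bar (Suc n)}" by (cases y) auto
  qed
  then show ?thesis
    using card_le_Unb[OF assms, of n] card_le_Bar[OF assms, of n] by simp
qed

section \<open>Semistandardness\<close>

definition col_le :: "'a::linorder list \<Rightarrow> 'a list \<Rightarrow> bool" where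
  "col_le C D \<longleftrightarrow> length D \<le> length C \<and> (\<forall>r<length D. C ! r \<le> D ! r)"

lemma successively_conv_nth:
  "successively P xs \<longleftrightarrow> (\<forall>j. Suc j < length xs \<longrightarrow> P (xs ! j) (xs ! Suc j))"
proof (induction P xs rule: successively.induct)
  case (3 P x y xs)
  then show ?case by (auto simp: nth_Cons split: nat.splits)
qed auto

lemma semistandard_iff:
  "semistandard T \<longleftrightarrow> (\<forall>C\<in>set T. sorted_wrt (<) C) \<and> successively col_le T"
  by (simp add: semistandard_def successively_conv_nth col_le_def)

lemma card_column_le:
  fixes C :: "'a::linorder list"
  assumes "sorted_wrt (<) C"
  shows "card {y \<in> set C. y \<le> x} = card {r. r < length C \<and> C ! r \<le> x}"
proof -
  have "card {y \<in> set C. y \<le> x} = card (set (filter (\<lambda>y. y \<le> x) C))" by simp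
  also have "\<dots> = length (filter (\<lambda>y. y \<le> x) C)"
    using assms by (intro distinct_card distinct_filter) (simp add: strict_sorted_iff)
  finally show ?thesis by (simp only: length_filter_conv_card)
qed

text \<open>If row r of C exceeded row r of D, or were missing, then at most r entries of C but at
  least r + 1 entries of D would be bounded by \<open>D ! r\<close>.\<close>

lemma col_le_iff_card:
  fixes C D :: "'a::linorder list"
  assumes "sorted_wrt (<) C" "sorted_wrt (<) D"
  shows "col_le C D \<longleftrightarrow> (\<forall>x. card {y \<in> set D. y \<le> x} \<le> card {y \<in> set C. y \<le> x})"
proof
  assume "col_le C D"
  then show "\<forall>x. card {y \<in> set D. y \<le> x} \<le> card {y \<in> set C. y \<le> x}"
    unfolding card_column_le[OF assms(1)] card_column_le[OF assms(2)] col_le_def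
    by (intro allI card_mono) fastforce+
next
  assume card: "\<forall>x. card {y \<in> set D. y \<le> x} \<le> card {y \<in> set C. y \<le> x}"
  have "r < length C \<and> C ! r \<le> D ! r" if r: "r < length D" for r
  proof (rule ccontr)
    assume neg: "\<not> (r < length C \<and> C ! r \<le> D ! r)"
    have "{s. s < length C \<and> C ! s \<le> D ! r} \<subseteq> {..<r}"
    proof
      fix s assume s: "s \<in> {s. s < length C \<and> C ! s \<le> D ! r}"
      show "s \<in> {..<r}"
      proof (rule ccontr)
        assume "s \<notin> {..<r}"
        then have "r \<le> s" "r < length C" using s by auto
        then have "C ! r \<le> C ! s"
          using assms(1) s by (metis le_less mem_Collect_eq order_refl sorted_wrt_nth_less)
        then show False using neg s \<open>r < length C\<close> by auto
      qed
    qed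
    then have "card {s. s < length C \<and> C ! s \<le> D ! r} \<le> r"
      using card_mono[of "{..<r}"] by fastforce
    moreover have "{..r} \<subseteq> {s. s < length D \<and> D ! s \<le> D ! r}"
      using assms(2) r
      by (auto simp: sorted_wrt_nth_less) (metis le_less order_refl sorted_wrt_nth_less)
    then have "Suc r \<le> card {s. s < length D \<and> D ! s \<le> D ! r}"
      using card_mono[of "{s. s < length D \<and> D ! s \<le> D ! r}" "{..r}"] by simp
    ultimately show False
      using card card_column_le[OF assms(1)] card_column_le[OF assms(2)] by (metis not_less_eq_eq order_trans)
  qed
  then show "col_le C D"
    unfolding col_le_def by (metis not_le_imp_less less_irrefl)
qed

lemma col_le_iff_counts:
  assumes "sorted_wrt (<) C" "sorted_wrt (<) D" "set C \<subseteq> calphabet n" "set D \<subseteq> calphabet n"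
  shows "col_le C D \<longleftrightarrow> (\<forall>k. ucount (set D) k \<le> ucount (set C) k \<and>
    int (card (set D)) - bcount (set D) k \<le> int (card (set C)) - bcount (set C) k)"
    (is "_ \<longleftrightarrow> (\<forall>k. ?P k)")
proof -
  let ?Q = "\<lambda>x. card {y \<in> set D. y \<le> x} \<le> card {y \<in> set C. y \<le> x}"
  have U: "?Q (Unb k) \<longleftrightarrow> ucount (set D) k \<le> ucount (set C) k" for k
    using card_le_Unb[OF assms(3), of k] card_le_Unb[OF assms(4), of k] by linarith
  have B: "?Q (Bar (Suc k)) \<longleftrightarrow>
      int (card (set D)) - bcount (set D) k \<le> int (card (set C)) - bcount (set C) k" for k
    using card_le_Bar[OF assms(3), of k] card_le_Bar[OF assms(4), of k] by linarith
  \<comment> \<open>The datatype also contains \<open>Bar 0\<close>, its greatest element; as a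
    threshold it compares heights only, which is the case k = 0.\<close>
  have le0: "y \<le> Bar 0" for y by (cases y) auto
  show ?thesis unfolding col_le_iff_card[OF assms(1,2)]
  proof
    assume "\<forall>x. ?Q x"
    then show "\<forall>k. ?P k" using U B by blast
  next
    assume P: "\<forall>k. ?P k"
    show "\<forall>x. ?Q x"
    proof
      fix x show "?Q x"
      proof (cases x)
        case (Unb k)
        then show ?thesis using U P by blast
      next
        case (Bar k)
        show ?thesis
        proof (cases k)
          case 0
          then show ?thesis using P[rule_format, of 0] Bar le0 by simp
        next
          case (Suc k')
          then show ?thesis using B P Bar by blast
        qed
      qed
    qed
  qed
qed

section \<open>Splitting a column\<close>

text \<open>At the least j \<open>\<ge>\<close> k where the two tails have equal size, the greedy choice has used every
  element of F between k and j.\<close>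

lemma greedy_matching:
  fixes zs ts :: "nat list"
  assumes desc: "sorted_wrt (>) zs"
    and lt: "length ts \<le> length zs" "\<And>i. i < length ts \<Longrightarrow> ts ! i < zs ! i"
    and max: "\<And>i f. i < length zs \<Longrightarrow> f \<in> F \<Longrightarrow> f < zs ! i \<Longrightarrow> (0 < i \<Longrightarrow> f < ts ! (i - 1)) \<Longrightarrow>
      i < length ts \<and> f \<le> ts ! i"
    and disj: "set zs \<inter> F = {}"
  obtains j where "k \<le> j"
    "card {i. i < length zs \<and> zs ! i > j} = card {i. i < length ts \<and> ts ! i > j}"
    "\<And>f. f \<in> F \<Longrightarrow> k < f \<Longrightarrow> f \<le> j \<Longrightarrow> f \<in> set ts"
proof -
  define P where "P = (\<lambda>j. k \<le> j \<and>
    card {i. i < length zs \<and> zs ! i > j} = card {i. i < length ts \<and> ts ! i > j})"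
  obtain b where b: "\<forall>z\<in>set zs \<union> set ts. z \<le> b"
    using finite_nat_set_iff_bounded_le[of "set zs \<union> set ts"] by auto
  \<comment> \<open>Beyond all entries both tails are empty, so a least j exists.\<close>
  then have "P (max k b)"
    unfolding P_def by (auto simp: not_less intro!: arg_cong[of _ _ card])
      (meson le_trans less_le_not_le max.bounded_iff nth_mem UnI1 UnI2)+
  define j where "j = (LEAST j. P j)"
  have "P j" unfolding j_def by (rule LeastI) fact
  have "f \<in> set ts" if f: "f \<in> F" "k < f" "f \<le> j" for f
  proof (rule ccontr)
    assume nt: "f \<notin> set ts"
    let ?Z = "{i. i < length zs \<and> zs ! i > f - 1}" and ?T = "{i. i < length ts \<and> ts ! i > f - 1}"
    have "\<not> P (f - 1)" using not_less_Least[of "f - 1" P] f unfolding j_def by fastforce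
    moreover have "?T \<subseteq> ?Z" using lt by fastforce
    ultimately have "?T \<noteq> ?Z" using f unfolding P_def by auto
    then have ex: "\<exists>i. i \<in> ?Z \<and> i \<notin> ?T" using \<open>?T \<subseteq> ?Z\<close> by blast
    \<comment> \<open>The first index where z_i \<ge> f while t_i is smaller than f or missing. The
      preceding t exceeds f, so f was still available and the greedy rule would have taken a letter
      at least as large.\<close>
    define i where "i = (LEAST i. i \<in> ?Z \<and> i \<notin> ?T)"
    have i: "i < length zs" "zs ! i > f - 1" "i < length ts \<Longrightarrow> ts ! i \<le> f - 1"
      using LeastI_ex[OF ex] unfolding i_def[symmetric] by auto
    have "zs ! i \<noteq> f" using disj f i by (metis IntI empty_iff nth_mem)
    then have "f < zs ! i" using i f by linarith
    moreover have "f < ts ! (i - 1)" if "0 < i"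
    proof -
      have "\<not> (i - 1 \<in> ?Z \<and> i - 1 \<notin> ?T)"
        using that not_less_Least[of "i - 1" "\<lambda>i. i \<in> ?Z \<and> i \<notin> ?T"] unfolding i_def[symmetric] by simp
      moreover have "zs ! (i - 1) > zs ! i" using desc i that by (simp add: sorted_wrt_iff_nth_less)
      ultimately have "i - 1 < length ts" "ts ! (i - 1) > f - 1" using i by auto
      then show ?thesis using nt f by (metis One_nat_def Suc_pred le_neq_implies_less not_less_eq
            nth_mem not_le less_nat_zero_code not_gr_zero)
    qed
    ultimately have "i < length ts" "f \<le> ts ! i" using max[OF i(1) f(1)] by auto
    then show False using i f by linarith
  qed
  then show ?thesis using that \<open>P j\<close> unfolding P_def by blast
qed

section \<open>Paired and free letters, and the greedy choice of the t_i\<close>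

definition paired :: "cletter set \<Rightarrow> nat set" where
  "paired S = {z. Unb z \<in> S \<and> Bar z \<in> S}"

definition free :: "cletter set \<Rightarrow> nat set" where
  "free S = {t. 1 \<le> t \<and> Unb t \<notin> S \<and> Bar t \<notin> S}"

text \<open>An index contributes 1 if both its letters occur, -1 if neither does and 0 otherwise.
  Slack is thus the excess of letters to be replaced over available replacements, as in a Hall
  condition.\<close>

lemma slack_eq: "slack S k = cnt (paired S) k - cnt (free S) k"
  by (induction k) (auto simp: slack_def paired_def free_def)

lemma finite_paired: "finite S \<Longrightarrow> finite (paired S)"
  unfolding paired_def
  by (rule finite_subset[of _ "Unb -` S"]) (auto intro: finite_vimageI simp: inj_on_def)

lemma doubled_eq: "doubled C = rev (sorted_list_of_set (paired (set C)))"
  by (simp add: doubled_def paired_def)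

lemma set_doubled: "set (doubled C) = paired (set C)"
  by (simp add: doubled_eq finite_paired)

lemma doubled_desc: "sorted_wrt (>) (doubled C)"
  by (simp add: doubled_eq sorted_wrt_rev)

lemma distinct_desc: "sorted_wrt (>) (xs :: nat list) \<Longrightarrow> distinct xs"
  using strict_sorted_iff[of "rev xs"] by (simp add: sorted_wrt_rev)

lemma card_nth_greater:
  fixes xs :: "nat list"
  assumes "distinct xs" "0 \<notin> set xs"
  shows "int (card {i. i < length xs \<and> xs ! i > j}) = int (length xs) - cnt (set xs) j"
proof -
  have "card {i. i < length xs \<and> xs ! i > j} = length (filter (\<lambda>x. x > j) xs)"
    by (simp only: length_filter_conv_card)
  moreover have "cnt (set xs) j = int (length (filter (\<lambda>x. \<not> x > j) xs))"
  proof -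
    have "{x \<in> set xs. 1 \<le> x \<and> x \<le> j} = set (filter (\<lambda>x. \<not> x > j) xs)"
      using assms(2) by (auto simp: Suc_le_eq intro: gr0I)
    then show ?thesis
      using assms(1) by (simp only: cnt_eq_card distinct_card[OF distinct_filter])
  qed
  ultimately show ?thesis
    using sum_length_filter_compl[of "\<lambda>x. x > j" xs] by linarith
qed

text \<open>Greedy choices for the first few z_i only: \<open>slack_admissible\<close> builds the
  list one letter at a time and inspects the prefix at which an extension would fail.\<close>

definition split_prefix :: "cletter list \<Rightarrow> nat list \<Rightarrow> bool" where
  "split_prefix C ts \<longleftrightarrow> length ts \<le> length (doubled C) \<and>
     (\<forall>i < length ts. ts ! i \<in> split_candidates C ts i \<and>
                      (\<forall>t \<in> split_candidates C ts i. t \<le> ts ! i))"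

lemma split_letters_iff:
  "split_letters C ts \<longleftrightarrow> split_prefix C ts \<and> length ts = length (doubled C)"
  by (auto simp: split_letters_def split_prefix_def)

lemma split_candidates_eq:
  "split_candidates C ts i =
     {t \<in> free (set C). t < doubled C ! i \<and> (0 < i \<longrightarrow> t < ts ! (i - 1))}"
  by (auto simp: split_candidates_def free_def)

context
  fixes C :: "cletter list" and n :: nat
  assumes C: "set C \<subseteq> calphabet n"
begin

lemma paired_bounds: "z \<in> paired (set C) \<Longrightarrow> 1 \<le> z \<and> z \<le> n"
  using C by (auto simp: paired_def calphabet_def)

lemma split_prefix_props:
  assumes "split_prefix C ts"
  shows "sorted_wrt (>) ts" "set ts \<subseteq> free (set C)" "distinct ts" "0 \<notin> set ts"
    "\<And>i. i < length ts \<Longrightarrow> ts ! i < doubled C ! i"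
    "\<And>i f. i < length ts \<Longrightarrow> f \<in> free (set C) \<Longrightarrow> f < doubled C ! i \<Longrightarrow>
      (0 < i \<Longrightarrow> f < ts ! (i - 1)) \<Longrightarrow> f \<le> ts ! i"
proof -
  have *: "ts ! i \<in> split_candidates C ts i" "\<forall>t \<in> split_candidates C ts i. t \<le> ts ! i"
    if "i < length ts" for i using assms that by (auto simp: split_prefix_def)
  have "transp ((>) :: nat \<Rightarrow> nat \<Rightarrow> bool)" by (auto simp: transp_def)
  then show desc: "sorted_wrt (>) ts"
    using * by (subst sorted_wrt_iff_nth_Suc_transp) (fastforce simp: split_candidates_eq)+
  show free: "set ts \<subseteq> free (set C)"
    using * by (auto simp: in_set_conv_nth split_candidates_eq)
  show "distinct ts" by (rule distinct_desc) fact
  show "0 \<notin> set ts" using free by (auto simp: free_def)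
  show "ts ! i < doubled C ! i" if "i < length ts" for i
    using *[OF that] by (simp add: split_candidates_eq)
  show "f \<le> ts ! i" if "i < length ts" "f \<in> free (set C)" "f < doubled C ! i"
    "0 < i \<Longrightarrow> f < ts ! (i - 1)" for i f
    using *(2)[OF that(1)] that by (simp add: split_candidates_eq)
qed

text \<open>Two estimates add up: since t_i < z_i, there are at least as many t as z up to j; and
  the t between k and j are free, so they number at most the free letters there.\<close>

lemma split_letters_lower:
  assumes "split_letters C ts" "k \<le> j"
  shows "slack (set C) j - slack (set C) k \<le> cnt (set ts) k - cnt (paired (set C)) k"
proof -
  have ts: "split_prefix C ts" "length ts = length (doubled C)"
    using assms by (auto simp: split_letters_iff)
  note props = split_prefix_props[OF ts(1)]
  have z: "distinct (doubled C)" "0 \<notin> set (doubled C)"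
    using doubled_desc distinct_desc paired_bounds[of 0] by (auto simp: set_doubled)
  have "{i. i < length ts \<and> ts ! i > j} \<subseteq> {i. i < length (doubled C) \<and> doubled C ! i > j}"
    using props(5) ts by fastforce
  then have "card {i. i < length ts \<and> ts ! i > j} \<le> card {i. i < length (doubled C) \<and> doubled C ! i > j}"
    by (intro card_mono) auto
  then have "cnt (paired (set C)) j \<le> cnt (set ts) j"
    using card_nth_greater[OF props(3,4), of j] card_nth_greater[OF z, of j] ts
    by (simp add: set_doubled)
  moreover have "cnt (set ts) j - cnt (set ts) k \<le> cnt (free (set C)) j - cnt (free (set C)) k"
    using assms(2) props(2) by (intro cnt_diff_mono) auto
  ultimately show ?thesis by (simp add: slack_eq)
qed

text \<open>At the j of \<open>greedy_matching\<close> both estimates of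
  \<open>split_letters_lower\<close> are equalities: as many t as z lie up to j, and every free
  letter above k and up to j is a t.\<close>

lemma split_letters_attained:
  assumes "split_letters C ts"
  obtains j where "k \<le> j"
    "cnt (set ts) k - cnt (paired (set C)) k \<le> slack (set C) j - slack (set C) k"
proof -
  have ts: "split_prefix C ts" "length ts = length (doubled C)"
    using assms by (auto simp: split_letters_iff)
  note props = split_prefix_props[OF ts(1)]
  have z: "distinct (doubled C)" "0 \<notin> set (doubled C)"
    using doubled_desc distinct_desc paired_bounds[of 0] by (auto simp: set_doubled)
  obtain j where j: "k \<le> j"
    "card {i. i < length (doubled C) \<and> doubled C ! i > j} = card {i. i < length ts \<and> ts ! i > j}"
    "\<And>f. f \<in> free (set C) \<Longrightarrow> k < f \<Longrightarrow> f \<le> j \<Longrightarrow> f \<in> set ts"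
  proof (rule greedy_matching[of "doubled C" ts "free (set C)" k])
    show "set (doubled C) \<inter> free (set C) = {}"
      by (auto simp: set_doubled paired_def free_def)
  qed (use props ts doubled_desc in auto)
  have "cnt (paired (set C)) j = cnt (set ts) j"
    using card_nth_greater[OF props(3,4), of j] card_nth_greater[OF z, of j] ts j(2)
    by (simp add: set_doubled)
  moreover have "cnt (free (set C)) j - cnt (free (set C)) k \<le> cnt (set ts) j - cnt (set ts) k"
    using j by (intro cnt_diff_mono) auto
  ultimately show ?thesis using j(1) that[of j] by (simp add: slack_eq)
qed

lemma split_letters_unique:
  assumes "split_letters C ts" "split_letters C ts'"
  shows "ts = ts'"
proof (rule nth_equalityI)
  show len: "length ts = length ts'" using assms by (simp add: split_letters_def)
  show "ts ! i = ts' ! i" if "i < length ts" for i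
    using that
  proof (induction i rule: less_induct)
    case (less i)
    then have "0 < i \<Longrightarrow> ts ! (i - 1) = ts' ! (i - 1)" by auto
    then have "split_candidates C ts i = split_candidates C ts' i"
      by (auto simp: split_candidates_def)
    then show ?case
      using assms less.prems len unfolding split_letters_def by (metis le_antisym)
  qed
qed

lemma admissible_slack:
  assumes "admissible C"
  shows "slack (set C) j \<le> 0"
proof -
  obtain ts where "split_letters C ts" using assms by (auto simp: admissible_def)
  from split_letters_lower[OF this, of 0 j] show ?thesis by (simp add: slack_def)
qed

text \<open>A Hall argument. If no letter is left for the next z, then
  \<open>greedy_matching\<close>, applied with one more z than t and k = 0, gives a j up to which
  there is one more z than t and every free letter is used; so the slack at j is at least 1.\<close>

lemma slack_admissible:
  assumes slack: "\<And>j. slack (set C) j \<le> 0"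
  shows "admissible C"
proof -
  let ?zs = "doubled C"
  have "\<exists>ts. split_prefix C ts \<and> length ts = l" if "l \<le> length ?zs" for l
    using that
  proof (induction l)
    case 0
    then show ?case by (auto simp: split_prefix_def)
  next
    case (Suc l)
    then obtain ts where ts: "split_prefix C ts" "length ts = l" by auto
    note props = split_prefix_props[OF ts(1)]
    have "split_candidates C ts l \<noteq> {}"
    proof
      assume none: "split_candidates C ts l = {}"
      let ?zl = "take (Suc l) ?zs"
      have zl: "length ?zl = Suc l" "distinct ?zl" "0 \<notin> set ?zl" "set ?zl \<subseteq> paired (set C)"
        using Suc.prems doubled_desc distinct_desc paired_bounds[of 0]
        by (auto simp: set_doubled[symmetric] dest: in_set_takeD)
      obtain j where j:
        "card {i. i < length ?zl \<and> ?zl ! i > j} = card {i. i < length ts \<and> ts ! i > j}"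
        "\<And>f. f \<in> free (set C) \<Longrightarrow> 0 < f \<Longrightarrow> f \<le> j \<Longrightarrow> f \<in> set ts"
      proof (rule greedy_matching[of ?zl ts "free (set C)" 0])
        show "sorted_wrt (>) ?zl" by (simp add: doubled_desc sorted_wrt_take)
        show "set ?zl \<inter> free (set C) = {}"
          using zl(4) by (auto simp: paired_def free_def)
        show "i < length ts \<and> f \<le> ts ! i"
          if "i < length ?zl" "f \<in> free (set C)" "f < ?zl ! i" "0 < i \<Longrightarrow> f < ts ! (i - 1)" for i f
        proof -
          have i: "i < Suc l" "f < ?zs ! i" using that zl(1) by auto
          \<comment> \<open>At the last index the maximality condition holds vacuously, as no
            candidate exists there.\<close>
          have "i \<noteq> l" using none i that by (auto simp: split_candidates_eq)
          then show ?thesis using props(6)[of i f] i that ts(2) by auto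
        qed
      qed (use props ts zl in auto)
      have "cnt (set ?zl) j = cnt (set ts) j + 1"
        using card_nth_greater[OF props(3,4), of j] card_nth_greater[OF zl(2,3), of j] ts j(1) zl(1)
        by linarith
      moreover have "cnt (free (set C)) j \<le> cnt (set ts) j"
        using cnt_diff_mono[of 0 j "free (set C)" "set ts"] j(2) by simp
      moreover have "cnt (set ?zl) j \<le> cnt (paired (set C)) j"
        using cnt_diff_mono[of 0 j "set ?zl" "paired (set C)"] zl(4) by auto
      ultimately show False using slack[of j] by (simp add: slack_eq)
    qed
    moreover have fin: "finite (split_candidates C ts l)"
      by (rule finite_subset[of _ "{..<?zs ! l}"]) (auto simp: split_candidates_def)
    ultimately have Max: "Max (split_candidates C ts l) \<in> split_candidates C ts l" by (rule Max_in[rotated])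
    let ?ts' = "ts @ [Max (split_candidates C ts l)]"
    have cand: "split_candidates C ?ts' i = split_candidates C ts i" if "i \<le> l" for i
      using that ts(2) by (auto simp: split_candidates_def nth_append)
    have "split_prefix C ?ts'"
      unfolding split_prefix_def
    proof (intro conjI allI impI)
      fix i assume "i < length ?ts'"
      then consider "i < l" | "i = l" using ts(2) by fastforce
      then have "?ts' ! i \<in> split_candidates C ?ts' i \<and> (\<forall>t\<in>split_candidates C ?ts' i. t \<le> ?ts' ! i)"
      proof cases
        case 1
        then show ?thesis using ts cand[of i] by (simp add: split_prefix_def nth_append)
      next
        case 2
        then show ?thesis using ts cand[of i] fin Max by (simp add: nth_append)
      qed
      then show "?ts' ! i \<in> split_candidates C ?ts' i"
        "\<forall>t\<in>split_candidates C ?ts' i. t \<le> ?ts' ! i" by auto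
    qed (use Suc.prems ts in auto)
    then show ?case using ts(2) by (intro exI[of _ ?ts']) auto
  qed
  then show ?thesis unfolding admissible_def split_letters_iff by blast
qed

lemma split_columns:
  assumes "admissible C"
  obtains c where
    "\<And>k j. k \<le> j \<Longrightarrow> slack (set C) j - slack (set C) k \<le> c k"
    "\<And>k. \<exists>j\<ge>k. c k \<le> slack (set C) j - slack (set C) k"
    "sorted_wrt (<) (left_col C)" "set (left_col C) \<subseteq> calphabet n"
    "\<And>k. ucount (set (left_col C)) k = ucount (set C) k + c k"
    "\<And>k. bcount (set (left_col C)) k = bcount (set C) k"
    "sorted_wrt (<) (right_col C)" "set (right_col C) \<subseteq> calphabet n"
    "\<And>k. ucount (set (right_col C)) k = ucount (set C) k"
    "\<And>k. bcount (set (right_col C)) k = bcount (set C) k + c k"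
    "card (set (left_col C)) = card (set C)" "card (set (right_col C)) = card (set C)"
proof -
  let ?S = "set C"
  obtain ts where ts: "split_letters C ts" using assms by (auto simp: admissible_def)
  have the: "the_split_letters C = ts"
    unfolding the_split_letters_def using ts split_letters_unique by blast
  let ?I = "paired ?S" and ?J = "set ts"
  define c where "c = (\<lambda>k. cnt ?J k - cnt ?I k)"
  have prefix: "split_prefix C ts" "length ts = length (doubled C)"
    using ts by (auto simp: split_letters_iff)
  note props = split_prefix_props[OF prefix(1)]
  have Jn: "t \<le> n" if "t \<in> ?J" for t
  proof -
    obtain i where i: "i < length ts" "t = ts ! i" using \<open>t \<in> ?J\<close> by (auto simp: in_set_conv_nth)
    then have "t < doubled C ! i" "doubled C ! i \<in> ?I"
      using props(5) prefix(2) by (auto simp flip: set_doubled)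
    then show ?thesis using paired_bounds by fastforce
  qed
  have J: "t \<in> ?J \<Longrightarrow> 1 \<le> t \<and> Unb t \<notin> ?S \<and> Bar t \<notin> ?S" for t
    using props(2) by (auto simp: free_def)
  have left: "set (left_col C) = (?S - Unb ` ?I) \<union> Unb ` ?J"
    and right: "set (right_col C) = (?S - Bar ` ?I) \<union> Bar ` ?J"
    by (simp_all add: left_col_def right_col_def the set_doubled)
  have counts: "ucount (set (left_col C)) k = ucount ?S k + c k"
    "bcount (set (left_col C)) k = bcount ?S k"
    "ucount (set (right_col C)) k = ucount ?S k"
    "bcount (set (right_col C)) k = bcount ?S k + c k" for k
  proof -
    have "Unb z \<in> Unb ` A \<longleftrightarrow> z \<in> A" "Bar z \<in> Bar ` A \<longleftrightarrow> z \<in> A" "Bar z \<notin> Unb ` A" "Unb z \<notin> Bar ` A"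
      for z A by auto
    then show "ucount (set (left_col C)) k = ucount ?S k + c k"
      "bcount (set (left_col C)) k = bcount ?S k"
      "ucount (set (right_col C)) k = ucount ?S k"
      "bcount (set (right_col C)) k = bcount ?S k + c k"
      unfolding left right c_def by (induction k) (auto simp: paired_def dest: J)
  qed
  have alph: "set (left_col C) \<subseteq> calphabet n" "set (right_col C) \<subseteq> calphabet n"
    unfolding left right using C J Jn by (auto simp: calphabet_def)
  have "cnt ?I n = int (length (doubled C)) - int (card {i. i < length (doubled C) \<and> doubled C ! i > n})"
  proof -
    have "distinct (doubled C)" "0 \<notin> set (doubled C)"
      using doubled_desc distinct_desc paired_bounds[of 0] by (auto simp: set_doubled)
    from card_nth_greater[OF this, of n] show ?thesis by (simp add: set_doubled)
  qed
  moreover have "{i. i < length (doubled C) \<and> doubled C ! i > n} = {}"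
  proof -
    have "doubled C ! i \<le> n" if "i < length (doubled C)" for i
      using paired_bounds[of "doubled C ! i"] nth_mem[OF that] by (simp add: set_doubled)
    then show ?thesis using leD by blast
  qed
  moreover have "{i. i < length ts \<and> ts ! i > n} = {}"
    using Jn nth_mem leD by blast
  \<comment> \<open>All z and t lie up to n and the two lists are equally long. This is why both
    split columns are as tall as C.\<close>
  ultimately have "c n = 0"
    using card_nth_greater[OF props(3,4), of n] prefix(2)
    by (simp only: c_def card.empty)
  show ?thesis
  proof (rule that[of c])
    show "slack ?S j - slack ?S k \<le> c k" if "k \<le> j" for k j
      using split_letters_lower[OF ts that] by (simp add: c_def)
    show "\<exists>j\<ge>k. c k \<le> slack ?S j - slack ?S k" for k
      using split_letters_attained[OF ts, of k] by (auto simp: c_def)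
    show "card (set (left_col C)) = card ?S" "card (set (right_col C)) = card ?S"
      using card_eq_counts[OF C] card_eq_counts[OF alph(1)] card_eq_counts[OF alph(2)] counts[of n] \<open>c n = 0\<close>
      by linarith+
    show "sorted_wrt (<) (left_col C)" "sorted_wrt (<) (right_col C)"
      by (simp_all add: left_col_def right_col_def)
  qed (use counts alph in auto)
qed

end

text \<open>The condition $rC \<le> \ell D$, unfolded: in \<open>split_columns\<close> the number c k is the maximum of
  slack j - slack k over j \<open>\<ge>\<close> k.\<close>

definition kn_le :: "cletter set \<Rightarrow> cletter set \<Rightarrow> bool" where
  "kn_le S S' \<longleftrightarrow> (\<forall>k j. k \<le> j \<longrightarrow>
     slack S' j \<le> ucount S k + bcount S' k - int k \<and>
     slack S j \<le> ucount S k + bcount S' k - int k + int (card S) - int (card S'))"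

lemma kn_le_iff:
  assumes "admissible C" "admissible D" "set C \<subseteq> calphabet n" "set D \<subseteq> calphabet n"
  shows "col_le (right_col C) (left_col D) \<longleftrightarrow> kn_le (set C) (set D)"
proof -
  obtain c where c:
    "\<And>k j. k \<le> j \<Longrightarrow> slack (set C) j - slack (set C) k \<le> c k"
    "\<And>k. \<exists>j\<ge>k. c k \<le> slack (set C) j - slack (set C) k"
    "sorted_wrt (<) (right_col C)" "set (right_col C) \<subseteq> calphabet n"
    "\<And>k. ucount (set (right_col C)) k = ucount (set C) k"
    "\<And>k. bcount (set (right_col C)) k = bcount (set C) k + c k"
    "card (set (right_col C)) = card (set C)"
    using split_columns[OF assms(3,1)] by metis
  obtain d where d:
    "\<And>k j. k \<le> j \<Longrightarrow> slack (set D) j - slack (set D) k \<le> d k"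
    "\<And>k. \<exists>j\<ge>k. d k \<le> slack (set D) j - slack (set D) k"
    "sorted_wrt (<) (left_col D)" "set (left_col D) \<subseteq> calphabet n"
    "\<And>k. ucount (set (left_col D)) k = ucount (set D) k + d k"
    "\<And>k. bcount (set (left_col D)) k = bcount (set D) k"
    "card (set (left_col D)) = card (set D)"
    using split_columns[OF assms(4,2)] by metis
  have "col_le (right_col C) (left_col D) \<longleftrightarrow> (\<forall>k. ucount (set D) k + d k \<le> ucount (set C) k \<and>
    int (card (set D)) - bcount (set D) k \<le> int (card (set C)) - (bcount (set C) k + c k))"
    by (simp add: col_le_iff_counts[OF c(3) d(3) c(4) d(4)] c(5-7) d(5-7))
  also have "\<dots> \<longleftrightarrow> (\<forall>k. \<forall>j\<ge>k. ucount (set D) k + (slack (set D) j - slack (set D) k) \<le> ucount (set C) k \<and>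
    int (card (set D)) - bcount (set D) k \<le>
    int (card (set C)) - (bcount (set C) k + (slack (set C) j - slack (set C) k)))"
    (is "(\<forall>k. ?P k \<and> ?Q k) \<longleftrightarrow> (\<forall>k. \<forall>j\<ge>k. ?P' k j \<and> ?Q' k j)")
  proof (intro iff_allI iffI allI impI)
    fix k j assume "?P k \<and> ?Q k" "k \<le> j"
    then show "?P' k j \<and> ?Q' k j" using c(1)[of k j] d(1)[of k j] by linarith
  next
    fix k assume *: "\<forall>j\<ge>k. ?P' k j \<and> ?Q' k j"
    obtain j where "j \<ge> k" "d k \<le> slack (set D) j - slack (set D) k" using d(2) by blast
    moreover obtain j' where "j' \<ge> k" "c k \<le> slack (set C) j' - slack (set C) k" using c(2) by blast
    ultimately show "?P k \<and> ?Q k" using *[rule_format, of j] *[rule_format, of j'] by linarith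
  qed
  \<comment> \<open>After expanding the slack at k, one count of each column cancels, and both
    inequalities are left with the mixed term
    \<open>ucount (set C) k + bcount (set D) k - int k\<close>.\<close>
  also have "\<dots> \<longleftrightarrow> kn_le (set C) (set D)"
    unfolding kn_le_def by (simp add: slack_def algebra_simps)
  finally show ?thesis .
qed

text \<open>The case j = k is the comparison of the unsplit columns, so in \<open>KN_iff\<close>
  semistandardness of the tableau follows from that of its split form.\<close>

lemma kn_le_counts:
  assumes "kn_le S S'"
  shows "ucount S' k \<le> ucount S k"
    "int (card S') - bcount S' k \<le> int (card S) - bcount S k"
  using assms[unfolded kn_le_def, rule_format, of k k] by (auto simp: slack_def)

lemma semistandard_split_iff:
  assumes "\<forall>C\<in>set T. sorted_wrt (<) C \<and> set C \<subseteq> calphabet n \<and> admissible C"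
  shows "semistandard (split_tableau T) \<longleftrightarrow> successively kn_le (map set T)"
proof -
  have lr: "sorted_wrt (<) (left_col C)" "sorted_wrt (<) (right_col C)" "col_le (left_col C) (right_col C)"
    if C: "C \<in> set T" for C
  proof -
    have "set C \<subseteq> calphabet n" "admissible C" using assms C by auto
    from split_columns[OF this] obtain c where c:
      "\<And>k j. k \<le> j \<Longrightarrow> slack (set C) j - slack (set C) k \<le> c k"
      "sorted_wrt (<) (left_col C)" "set (left_col C) \<subseteq> calphabet n"
      "\<And>k. ucount (set (left_col C)) k = ucount (set C) k + c k"
      "\<And>k. bcount (set (left_col C)) k = bcount (set C) k"
      "sorted_wrt (<) (right_col C)" "set (right_col C) \<subseteq> calphabet n"
      "\<And>k. ucount (set (right_col C)) k = ucount (set C) k"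
      "\<And>k. bcount (set (right_col C)) k = bcount (set C) k + c k"
      "card (set (left_col C)) = card (set C)" "card (set (right_col C)) = card (set C)"
      by metis
    \<comment> \<open>This makes the comparison of \<open>left_col C\<close> with
      \<open>right_col C\<close> automatic; only comparisons across adjacent columns remain.\<close>
    have "0 \<le> c k" for k using c(1)[of k k] by simp
    then show "sorted_wrt (<) (left_col C)" "sorted_wrt (<) (right_col C)"
      "col_le (left_col C) (right_col C)"
      using c by (simp_all add: col_le_iff_counts[OF c(2,6,3,7)])
  qed
  have "successively col_le (split_tableau T) \<longleftrightarrow>
      successively (\<lambda>C D. col_le (right_col C) (left_col D)) T"
    using lr(3) unfolding split_tableau_def
    by (induction "\<lambda>C D. col_le (right_col C) (left_col D)" T rule: successively.induct) auto
  also have "\<dots> \<longleftrightarrow> successively kn_le (map set T)"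
    unfolding successively_map using assms kn_le_iff[where n = n] by (intro successively_cong) auto
  finally show ?thesis
    unfolding semistandard_iff using lr by (auto simp: split_tableau_def)
qed

lemma KN_iff:
  "T \<in> KN n \<mu> \<longleftrightarrow> has_shape \<mu> T \<and>
     (\<forall>C\<in>set T. sorted_wrt (<) C \<and> set C \<subseteq> calphabet n \<and> (\<forall>j. slack (set C) j \<le> 0)) \<and>
     successively kn_le (map set T)"
proof -
  have adm: "admissible C \<longleftrightarrow> (\<forall>j. slack (set C) j \<le> 0)" if "set C \<subseteq> calphabet n" for C
    using admissible_slack slack_admissible that by blast
  have col: "successively col_le T" if "successively kn_le (map set T)"
    "\<forall>C\<in>set T. sorted_wrt (<) C \<and> set C \<subseteq> calphabet n"
    using that(1) unfolding successively_map
    by (rule successively_mono) (use that(2) kn_le_counts col_le_iff_counts in blast)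
  show ?thesis
    unfolding KN_def semistandard_iff[of T] mem_Collect_eq
    using adm col semistandard_split_iff[of T n] by blast
qed

section \<open>Raising a letter\<close>

lemma less_cletter_simps [simp]:
  "Unb a < Unb b \<longleftrightarrow> a < b" "Unb a < Bar b" "\<not> Bar a < Unb b" "Bar a < Bar b \<longleftrightarrow> b < a"
  by (auto simp: less_cletter_def)

lemma kn_le_raise_Unb:
  assumes i: "i = Suc l" and D: "Unb i \<notin> D" "Unb (Suc i) \<in> D" "Bar i \<in> D \<longrightarrow> Bar (Suc i) \<in> D"
    and D': "D' = insert (Unb i) (D - {Unb (Suc i)})" "card D' = card D"
  shows "(\<And>j. slack D j \<le> 0) \<Longrightarrow> slack D' j \<le> 0"
    "kn_le D E \<Longrightarrow> kn_le D' E"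
    "kn_le C D \<Longrightarrow> (Bar (Suc i) \<notin> D \<Longrightarrow> Unb i \<in> C \<or> Unb (Suc i) \<notin> C) \<Longrightarrow> kn_le C D'"
proof -
  have u: "ucount D' k = ucount D k + of_bool (k = i)" for k
    unfolding D' using D i by (induction k) auto
  have b: "bcount D' k = bcount D k" for k
    unfolding D' by (induction k) auto
  have s: "slack D' k = slack D k + of_bool (k = i)" for k
    by (simp add: slack_def u b)
  \<comment> \<open>If \<open>Bar i\<close> is absent, the index i contributes -1; if it is present,
    i + 1 is paired and contributes 1. So the raised value at i is already reached at a
    neighbour.\<close>
  have max: "slack D i + 1 \<le> slack D l \<or> slack D i + 1 \<le> slack D (Suc i)"
    using D by (auto simp: slack_def i)
  show "slack D' j \<le> 0" if "\<And>j. slack D j \<le> 0"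
    using max that[of l] that[of "Suc i"] that[of j] s[of j] by (cases "j = i") auto
  show "kn_le D' E" if le: "kn_le D E"
    unfolding kn_le_def u b s D'(2)
  proof (intro allI impI conjI)
    fix k j :: nat assume kj: "k \<le> j"
    note le = le[unfolded kn_le_def, rule_format]
    show "slack E j \<le> ucount D k + of_bool (k = i) + bcount E k - int k"
      using le[OF kj] by (cases "k = i") auto
    show "slack D j + of_bool (j = i) \<le>
        ucount D k + of_bool (k = i) + bcount E k - int k + int (card D) - int (card E)"
    proof (cases "j = i \<and> k \<noteq> i")
      case True
      then have "k \<le> l" "k \<le> Suc i" using kj i by auto
      then show ?thesis using max le[of k l] le[of k "Suc i"] True by auto
    next
      case False
      then show ?thesis using le[OF kj] by (cases "k = i") auto
    qed
  qed
  show "kn_le C D'" if le: "kn_le C D" and C: "Bar (Suc i) \<notin> D \<Longrightarrow> Unb i \<in> C \<or> Unb (Suc i) \<notin> C"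
    unfolding kn_le_def u b s D'(2)
  proof (intro allI impI conjI)
    fix k j :: nat assume kj: "k \<le> j"
    note le = le[unfolded kn_le_def, rule_format]
    show "slack C j \<le> ucount C k + bcount D k - int k + int (card C) - int (card D)"
      using le[OF kj] by simp
    show "slack D j + of_bool (j = i) \<le> ucount C k + bcount D k - int k"
    proof (cases "j = i")
      case True
      show ?thesis
      proof (cases "k = i")
        case False
        then have "k \<le> l" "k \<le> Suc i" using kj i True by auto
        then show ?thesis using max le[of k l] le[of k "Suc i"] True by auto
      next
        \<comment> \<open>Now j = i - 1 is out of range, and the claim reads
          \<open>ucount D i < ucount C i\<close>. It follows from the bounds at i - 1 if C contains
          \<open>Unb i\<close>, from those at i + 1 if C lacks \<open>Unb (Suc i)\<close>, and from
          k = i, j = i + 1 if D contains \<open>Bar (Suc i)\<close>.\<close>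
        case k: True
        show ?thesis
        proof (rule ccontr)
          assume "\<not> ?thesis"
          then show False
            using le[of l l] le[of i i] le[of "Suc i" "Suc i"] le[of i "Suc i"] D C
            by (auto simp: slack_def i k True of_bool_def split: if_splits)
        qed
      qed
    qed (use le[OF kj] in simp)
  qed
qed

text \<open>Write R(k) = ucount C k + bcount D k - k. Against the left neighbour only the bounds
  with k = i tighten, and R(i) - 1 equals R(i - 1) if C contains \<open>Unb i\<close> and R(i + 1)
  if C lacks \<open>Unb (Suc i)\<close>. The last condition on C serves j = i, where k = i + 1 is
  out of range.\<close>

lemma kn_le_raise_Bar:
  assumes i: "i = Suc l" and D: "Bar i \<in> D" "Bar (Suc i) \<notin> D"
    and D': "D' = insert (Bar (Suc i)) (D - {Bar i})" "card D' = card D"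
  shows "(\<And>j. slack D j \<le> 0) \<Longrightarrow> slack D' j \<le> 0"
    "kn_le D E \<Longrightarrow> kn_le D' E"
    "kn_le C D \<Longrightarrow> Unb i \<in> C \<or> Unb (Suc i) \<notin> C \<Longrightarrow>
      (Bar i \<in> C \<Longrightarrow> Bar (Suc i) \<notin> C \<Longrightarrow> Unb i \<in> C) \<Longrightarrow> kn_le C D'"
proof -
  have u: "ucount D' k = ucount D k" for k
    unfolding D' by (induction k) auto
  have b: "bcount D' k = bcount D k - of_bool (k = i)" for k
    unfolding D' using D i by (induction k) auto
  have s: "slack D' k = slack D k - of_bool (k = i)" for k
    by (simp add: slack_def u b)
  show "slack D' j \<le> 0" if "\<And>j. slack D j \<le> 0"
    using that[of j] s[of j] by (cases "j = i") auto
  show "kn_le D' E" if le: "kn_le D E"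
    unfolding kn_le_def u s D'(2)
  proof (intro allI impI)
    fix k j :: nat assume kj: "k \<le> j"
    show "slack E j \<le> ucount D k + bcount E k - int k \<and>
      slack D j - of_bool (j = i) \<le> ucount D k + bcount E k - int k + int (card D) - int (card E)"
      using le[unfolded kn_le_def, rule_format, OF kj] by (auto simp: of_bool_def)
  qed
  show "kn_le C D'" if le: "kn_le C D" and C: "Unb i \<in> C \<or> Unb (Suc i) \<notin> C"
    "Bar i \<in> C \<Longrightarrow> Bar (Suc i) \<notin> C \<Longrightarrow> Unb i \<in> C"
    unfolding kn_le_def b s D'(2)
  proof (intro allI impI)
    fix k j :: nat assume kj: "k \<le> j"
    note le = le[unfolded kn_le_def, rule_format]
    show "slack D j - of_bool (j = i) \<le> ucount C k + (bcount D k - of_bool (k = i)) - int k \<and>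
      slack C j \<le> ucount C k + (bcount D k - of_bool (k = i)) - int k + int (card C) - int (card D)"
    proof (cases "k = i")
      case False
      then show ?thesis using le[OF kj] by (auto simp: of_bool_def)
    next
      case k: True
      show ?thesis
      proof (cases "j = i")
        case True
        then show ?thesis
          using le[of l l] le[of i i] le[of "Suc i" "Suc i"] le[of l i] D C
          by (auto simp: slack_def i k of_bool_def split: if_splits)
      next
        case False
        then have "l \<le> j" "Suc i \<le> j" using kj i k by auto
        then show ?thesis
          using le[of l j] le[of "Suc i" j] C(1) D False
          by (auto simp: i k of_bool_def split: if_splits)
      qed
    qed
  qed
qed

lemma counts_ge:
  assumes "S \<subseteq> calphabet n" "n \<le> k"
  shows "ucount S k = ucount S n" "bcount S k = bcount S n"
proof -
  have "Unb j \<notin> S" "Bar j \<notin> S" if "j > n" for j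
    using assms(1) that by (auto simp: calphabet_def)
  with assms(2) have "ucount S k = ucount S n \<and> bcount S k = bcount S n"
    by (induction k rule: dec_induct) auto
  then show "ucount S k = ucount S n" "bcount S k = bcount S n" by auto
qed

text \<open>The two counts shift in opposite directions, so the slack stays and only the bounds
  against the left neighbour with k \<ge> n tighten. From n on the counts are constant, and
  everything reduces to \<open>ucount D n < ucount C n\<close>.\<close>

lemma kn_le_raise_last:
  assumes n: "n = Suc l" and D: "Unb n \<notin> D" "Bar n \<in> D" "D \<subseteq> calphabet n"
    and D': "D' = insert (Unb n) (D - {Bar n})" "card D' = card D"
  shows "(\<And>j. slack D j \<le> 0) \<Longrightarrow> slack D' j \<le> 0"
    "kn_le D E \<Longrightarrow> kn_le D' E"
    "kn_le C D \<Longrightarrow> C \<subseteq> calphabet n \<Longrightarrow> Unb n \<in> C \<or> Bar n \<notin> C \<Longrightarrow> kn_le C D'"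
proof -
  have "n \<noteq> 0" using n by simp
  have u: "ucount D' k = ucount D k + of_bool (n \<le> k)" for k
    unfolding D' using D(1,2) \<open>n \<noteq> 0\<close> by (induction k) (auto simp: of_bool_def le_Suc_eq)
  have b: "bcount D' k = bcount D k - of_bool (n \<le> k)" for k
    unfolding D' using D(1,2) \<open>n \<noteq> 0\<close> by (induction k) (auto simp: of_bool_def le_Suc_eq)
  have s: "slack D' k = slack D k" for k
    by (simp add: slack_def u b)
  show "slack D' j \<le> 0" if "\<And>j. slack D j \<le> 0"
    using that[of j] s[of j] by simp
  show "kn_le D' E" if le: "kn_le D E"
    unfolding kn_le_def u s D'(2)
  proof (intro allI impI)
    fix k j :: nat assume kj: "k \<le> j"
    show "slack E j \<le> ucount D k + of_bool (n \<le> k) + bcount E k - int k \<and>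
      slack D j \<le> ucount D k + of_bool (n \<le> k) + bcount E k - int k + int (card D) - int (card E)"
      using le[unfolded kn_le_def, rule_format, OF kj] by (auto simp: of_bool_def)
  qed
  show "kn_le C D'" if le: "kn_le C D" and C: "C \<subseteq> calphabet n" "Unb n \<in> C \<or> Bar n \<notin> C"
    unfolding kn_le_def b s D'(2)
  proof (intro allI impI)
    fix k j :: nat assume kj: "k \<le> j"
    note le = le[unfolded kn_le_def, rule_format]
    have h: "int (card D) = ucount D n + bcount D n" "int (card C) = ucount C n + bcount C n"
      using card_eq_counts C D by auto
    \<comment> \<open>From the unbarred counts at n - 1 if C contains \<open>Unb n\<close>;
      otherwise from the barred counts there, as D contains \<open>Bar n\<close> and C does
      not.\<close>
    have strict: "ucount D n + 1 \<le> ucount C n"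
      using le[of l l] le[of n n] D C(2) h
      by (auto simp: slack_def n of_bool_def split: if_splits)
    show "slack D j \<le> ucount C k + (bcount D k - of_bool (n \<le> k)) - int k \<and>
      slack C j \<le> ucount C k + (bcount D k - of_bool (n \<le> k)) - int k + int (card C) - int (card D)"
    proof (cases "n \<le> k")
      case False
      then show ?thesis using le[OF kj] by simp
    next
      case True
      then have "n \<le> j" using kj by simp
      then show ?thesis
        using strict h kj True counts_ge[OF C(1) True] counts_ge[OF D(3) True]
          counts_ge[OF C(1) \<open>n \<le> j\<close>] counts_ge[OF D(3) \<open>n \<le> j\<close>]
        by (simp add: slack_def)
    qed
  qed
qed

section \<open>The signature of a single column\<close>

lemma map_filter_sorted:
  fixes L ks :: "'a::linorder list"
  assumes "sorted_wrt (<) L" "sorted_wrt (<) ks" "\<And>x. x \<notin> set ks \<Longrightarrow> mark x = None"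
  shows "List.map_filter mark L = List.map_filter mark (filter (\<lambda>x. x \<in> set L) ks)"
proof -
  have "List.map_filter mark L = List.map_filter mark (filter (\<lambda>x. x \<in> set ks) L)"
    using assms(3) by (induction L) (auto split: option.split)
  moreover have "filter (\<lambda>x. x \<in> set ks) L = filter (\<lambda>x. x \<in> set L) ks"
    by (rule strict_sorted_equal) (use assms(1,2) in \<open>auto simp: sorted_wrt_filter\<close>)
  ultimately show ?thesis by simp
qed

lemma column_signature:
  assumes "sorted_wrt (<) L" "i < n"
  shows "List.map_filter (mark_C n i) L =
    (if Unb i \<in> set L then [Plus] else []) @ (if Unb (Suc i) \<in> set L then [Minus] else []) @
    (if Bar (Suc i) \<in> set L then [Plus] else []) @ (if Bar i \<in> set L then [Minus] else [])"
proof -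
  have "List.map_filter (mark_C n i) L =
      List.map_filter (mark_C n i) (filter (\<lambda>x. x \<in> set L) [Unb i, Unb (Suc i), Bar (Suc i), Bar i])"
    by (rule map_filter_sorted) (use assms in \<open>auto simp: mark_C_def\<close>)
  then show ?thesis using assms(2) by (simp add: mark_C_def)
qed

lemma column_signature_last:
  assumes "sorted_wrt (<) L"
  shows "List.map_filter (mark_C n n) L =
    (if Unb n \<in> set L then [Plus] else []) @ (if Bar n \<in> set L then [Minus] else [])"
proof -
  have "List.map_filter (mark_C n n) L =
      List.map_filter (mark_C n n) (filter (\<lambda>x. x \<in> set L) [Unb n, Bar n])"
    by (rule map_filter_sorted) (use assms in \<open>auto simp: mark_C_def\<close>)
  then show ?thesis by (simp add: mark_C_def)
qed

text \<open>At most four letters are marked, with signs + - + - in reading order, so sixteen columns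
  are to be checked. The conclusions are the membership conditions that the raising lemmas require
  of the column and of its left neighbour.\<close>

lemma signature_cases:
  assumes "sorted_wrt (<) L" "i < n"
  shows "eps (List.map_filter (mark_C n i) L) = 0 \<Longrightarrow>
      (Unb i \<in> set L \<or> Unb (Suc i) \<notin> set L) \<and>
      (Bar i \<in> set L \<longrightarrow> Bar (Suc i) \<in> set L \<or> Unb i \<in> set L)"
    "phi (List.map_filter (mark_C n i) L) = 0 \<Longrightarrow>
      (Unb i \<in> set L \<longrightarrow> Unb (Suc i) \<in> set L \<or> Bar i \<in> set L) \<and>
      (Bar (Suc i) \<in> set L \<longrightarrow> Bar i \<in> set L)"
    "Unb i \<notin> set L \<Longrightarrow> Bar (Suc i) \<notin> set L \<Longrightarrow> phi (List.map_filter (mark_C n i) L) = 0"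
  unfolding column_signature[OF assms]
  subgoal
    by (cases "Unb i \<in> set L"; cases "Unb (Suc i) \<in> set L"; cases "Bar (Suc i) \<in> set L";
        cases "Bar i \<in> set L") simp_all
  subgoal
    by (cases "Unb i \<in> set L"; cases "Unb (Suc i) \<in> set L"; cases "Bar (Suc i) \<in> set L";
        cases "Bar i \<in> set L") simp_all
  subgoal
    by (cases "Unb i \<in> set L"; cases "Unb (Suc i) \<in> set L"; cases "Bar (Suc i) \<in> set L";
        cases "Bar i \<in> set L") simp_all
  done

lemma signature_cases_last:
  assumes "sorted_wrt (<) L"
  shows "eps (List.map_filter (mark_C n n) L) = 0 \<Longrightarrow> Unb n \<in> set L \<or> Bar n \<notin> set L"
    "phi (List.map_filter (mark_C n n) L) = 0 \<Longrightarrow> Unb n \<in> set L \<longrightarrow> Bar n \<in> set L"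
    "Unb n \<notin> set L \<Longrightarrow> phi (List.map_filter (mark_C n n) L) = 0"
  unfolding column_signature_last[OF assms]
  subgoal by (cases "Unb n \<in> set L"; cases "Bar n \<in> set L") simp_all
  subgoal by (cases "Unb n \<in> set L"; cases "Bar n \<in> set L") simp_all
  subgoal by (cases "Unb n \<in> set L"; cases "Bar n \<in> set L") simp_all
  done

fun rank :: "nat \<Rightarrow> cletter \<Rightarrow> nat" where
  "rank n (Unb x) = x"
| "rank n (Bar x) = 2 * n + 1 - x"

lemma sorted_replace:
  fixes u v :: "'a::linorder list"
  assumes "sorted_wrt (<) (u @ x # v)" "y < x" "\<And>w. w < x \<Longrightarrow> y \<le> w \<Longrightarrow> w \<notin> set u"
  shows "sorted_wrt (<) (u @ y # v)" "set (u @ y # v) = insert y (set (u @ x # v) - {x})"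
    "card (set (u @ y # v)) = card (set (u @ x # v))"
proof -
  show s: "sorted_wrt (<) (u @ y # v)"
  proof -
    have "w < y" if "w \<in> set u" for w
      using assms(1,3) that by (meson UnCI less_le_not_le linorder_not_le list.set_intros(1) sorted_wrt_append)
    then show ?thesis
      using assms(1,2) by (auto simp: sorted_wrt_append intro: less_trans)
  qed
  show "set (u @ y # v) = insert y (set (u @ x # v) - {x})"
    using assms(1) by (auto simp: sorted_wrt_append)
  have "distinct (u @ x # v)" "distinct (u @ y # v)"
    using s assms(1) strict_sorted_iff by blast+
  then show "card (set (u @ y # v)) = card (set (u @ x # v))"
    by (simp only: distinct_card length_append length_Cons)
qed

text \<open>The bound on the signature of C says that the Minus letters of the column C to the left are
  cancelled by the Plus letters below x, which holds when x is the rightmost uncancelled Minus.\<close>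

lemma raise_column:
  assumes i: "1 \<le> i" "i \<le> n" and sorted: "sorted_wrt (<) (u @ x # v)"
    and alph: "set (u @ x # v) \<subseteq> calphabet n"
    and x: "mark_C n i x = Some Minus"
    and u: "phi (List.map_filter (mark_C n i) u) = 0"
    and v: "eps (List.map_filter (mark_C n i) v) = 0"
    and slack: "\<And>j. slack (set (u @ x # v)) j \<le> 0"
  obtains y where "mark_C n i y = Some Plus" "move_C n i y = x" "rank n y < rank n x"
    "sorted_wrt (<) (u @ y # v)" "set (u @ y # v) \<subseteq> calphabet n"
    "\<And>j. slack (set (u @ y # v)) j \<le> 0"
    "\<And>E. kn_le (set (u @ x # v)) E \<Longrightarrow> kn_le (set (u @ y # v)) E"
    "\<And>C. sorted_wrt (<) C \<Longrightarrow> set C \<subseteq> calphabet n \<Longrightarrow>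
      eps (List.map_filter (mark_C n i) C) \<le> phi (List.map_filter (mark_C n i) v) \<Longrightarrow>
      kn_le (set C) (set (u @ x # v)) \<Longrightarrow> kn_le (set C) (set (u @ y # v))"
proof -
  let ?D = "set (u @ x # v)"
  obtain l where l: "i = Suc l" using i by (cases i) auto
  have su: "sorted_wrt (<) u" "sorted_wrt (<) v" "\<And>w. w \<in> set u \<Longrightarrow> w < x" "\<And>w. w \<in> set v \<Longrightarrow> x < w"
    using sorted by (auto simp: sorted_wrt_append)
  consider "i < n" "x = Unb (Suc i)" | "i < n" "x = Bar i" | "i = n" "x = Bar n"
    using x i by (cases "i < n") (auto simp: mark_C_def split: if_splits)
  then show ?thesis
  proof cases
    case 1
    have nu: "Unb (Suc i) \<notin> set u" "Bar (Suc i) \<notin> set u" "Bar i \<notin> set u" "Unb i \<notin> set v"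
      "Unb (Suc i) \<notin> set v"
      using su(3,4) 1(2) by fastforce+
    have D: "Unb i \<notin> ?D" "Unb (Suc i) \<in> ?D" "Bar i \<in> ?D \<longrightarrow> Bar (Suc i) \<in> ?D"
      using signature_cases(2)[OF su(1) 1(1) u] signature_cases(1)[OF su(2) 1(1) v] nu
      by (auto simp: 1(2))
    have "w \<notin> set u" if "w < x" "Unb i \<le> w" for w
      using that D(1) 1(2) by (cases w) (auto simp: less_Suc_eq)
    moreover have "Unb i < x" using 1 by simp
    ultimately have rep: "sorted_wrt (<) (u @ Unb i # v)"
      "set (u @ Unb i # v) = insert (Unb i) (?D - {x})"
      "card (set (u @ Unb i # v)) = card ?D"
      by (intro sorted_replace[OF sorted]; blast)+
    have rep': "set (u @ Unb i # v) = insert (Unb i) (?D - {Unb (Suc i)})"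
      using rep(2) by (simp only: 1(2))
    note raise = kn_le_raise_Unb[OF l D rep' rep(3)]
    show ?thesis
    proof (rule that[of "Unb i"])
      show "mark_C n i (Unb i) = Some Plus" "move_C n i (Unb i) = x" "rank n (Unb i) < rank n x"
        using 1 by (simp_all add: mark_C_def move_C_def)
      show "set (u @ Unb i # v) \<subseteq> calphabet n"
        unfolding rep(2) using alph i by (auto simp: calphabet_def)
      show "slack (set (u @ Unb i # v)) j \<le> 0" for j using raise(1) slack by blast
      show "kn_le (set C) (set (u @ Unb i # v))"
        if C: "sorted_wrt (<) C" "eps (List.map_filter (mark_C n i) C) \<le> phi (List.map_filter (mark_C n i) v)"
        "kn_le (set C) ?D" for C
      proof (rule raise(3)[OF C(3)])
        assume "Bar (Suc i) \<notin> ?D"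
        then show "Unb i \<in> set C \<or> Unb (Suc i) \<notin> set C"
          \<comment> \<open>Without \<open>Bar (Suc i)\<close> the part \<open>v\<close> supplies no
            Plus, so no Minus of C survives.\<close>
          using C(2) signature_cases(3)[OF su(2) 1(1)] nu signature_cases(1)[OF C(1) 1(1)] by auto
      qed
      show "sorted_wrt (<) (u @ Unb i # v)" by (rule rep(1))
      show "kn_le (set (u @ Unb i # v)) E" if "kn_le ?D E" for E using that by (rule raise(2))
    qed
  next
    case 2
    have nu: "Bar i \<notin> set u" "Unb i \<notin> set v" "Bar i \<notin> set v" "Unb (Suc i) \<notin> set v" "Bar (Suc i) \<notin> set v"
      using su(3,4) 2(2) by fastforce+
    have D: "Bar i \<in> ?D" "Bar (Suc i) \<notin> ?D"
      using signature_cases(2)[OF su(1) 2(1) u] nu by (auto simp: 2(2))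
    have "w \<notin> set u" if "w < x" "Bar (Suc i) \<le> w" for w
      using that D(2) 2(2) by (cases w) (auto simp: le_Suc_eq)
    moreover have "Bar (Suc i) < x" using 2 by simp
    ultimately have rep: "sorted_wrt (<) (u @ Bar (Suc i) # v)"
      "set (u @ Bar (Suc i) # v) = insert (Bar (Suc i)) (?D - {x})"
      "card (set (u @ Bar (Suc i) # v)) = card ?D"
      by (intro sorted_replace[OF sorted]; blast)+
    have rep': "set (u @ Bar (Suc i) # v) = insert (Bar (Suc i)) (?D - {Bar i})"
      using rep(2) by (simp only: 2(2))
    note raise = kn_le_raise_Bar[OF l D rep' rep(3)]
    show ?thesis
    proof (rule that[of "Bar (Suc i)"])
      show "mark_C n i (Bar (Suc i)) = Some Plus" "move_C n i (Bar (Suc i)) = x"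
        "rank n (Bar (Suc i)) < rank n x"
        using 2 by (auto simp add: mark_C_def move_C_def)
      show "set (u @ Bar (Suc i) # v) \<subseteq> calphabet n"
        unfolding rep(2) using alph 2 by (auto simp: calphabet_def)
      show "slack (set (u @ Bar (Suc i) # v)) j \<le> 0" for j using raise(1) slack by blast
      show "kn_le (set C) (set (u @ Bar (Suc i) # v))"
        if C: "sorted_wrt (<) C" "eps (List.map_filter (mark_C n i) C) \<le> phi (List.map_filter (mark_C n i) v)"
        "kn_le (set C) ?D" for C
      proof -
        \<comment> \<open>\<open>v\<close> follows \<open>Bar i\<close>, the greatest marked letter,
          so it has no Plus to cancel a Minus of C.\<close>
        have "eps (List.map_filter (mark_C n i) C) = 0"
          using C(2) signature_cases(3)[OF su(2) 2(1) nu(2,5)] by simp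
        from signature_cases(1)[OF C(1) 2(1) this] show ?thesis
          by (intro raise(3)[OF C(3)]) blast+
      qed
      show "sorted_wrt (<) (u @ Bar (Suc i) # v)" by (rule rep(1))
      show "kn_le (set (u @ Bar (Suc i) # v)) E" if "kn_le ?D E" for E using that by (rule raise(2))
    qed
  next
    case 3
    have nu: "Bar n \<notin> set u" "Unb n \<notin> set v" "Bar n \<notin> set v"
      using su(3,4) 3(2) by fastforce+
    have D: "Unb n \<notin> ?D" "Bar n \<in> ?D"
      using signature_cases_last(2)[OF su(1) u[unfolded 3(1)]] nu by (auto simp: 3(2))
    have "w \<notin> set u" if "w < x" "Unb n \<le> w" for w
    proof
      assume "w \<in> set u"
      then have "w \<in> calphabet n" using alph by auto
      then show False using that D(1) 3(2) \<open>w \<in> set u\<close> by (cases w) (auto simp: calphabet_def)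
    qed
    moreover have "Unb n < x" using 3 by simp
    ultimately have rep: "sorted_wrt (<) (u @ Unb n # v)"
      "set (u @ Unb n # v) = insert (Unb n) (?D - {x})"
      "card (set (u @ Unb n # v)) = card ?D"
      by (intro sorted_replace[OF sorted]; blast)+
    have rep': "set (u @ Unb n # v) = insert (Unb n) (?D - {Bar n})"
      using rep(2) by (simp only: 3(2))
    note raise = kn_le_raise_last[OF l[unfolded 3(1)] D alph rep' rep(3)]
    show ?thesis
    proof (rule that[of "Unb n"])
      show "mark_C n i (Unb n) = Some Plus" "move_C n i (Unb n) = x" "rank n (Unb n) < rank n x"
        using 3 by (simp_all add: mark_C_def move_C_def)
      show "set (u @ Unb n # v) \<subseteq> calphabet n"
        unfolding rep(2) using alph i by (auto simp: calphabet_def)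
      show "slack (set (u @ Unb n # v)) j \<le> 0" for j using raise(1) slack by blast
      show "kn_le (set C) (set (u @ Unb n # v))"
        if C: "sorted_wrt (<) C" "set C \<subseteq> calphabet n"
        "eps (List.map_filter (mark_C n i) C) \<le> phi (List.map_filter (mark_C n i) v)"
        "kn_le (set C) ?D" for C
      proof -
        have "eps (List.map_filter (mark_C n n) C) = 0"
          using C(3) signature_cases_last(3)[OF su(2) nu(2)] 3(1) by simp
        from signature_cases_last(1)[OF C(1) this] show ?thesis
          by (rule raise(3)[OF C(4,2)])
      qed
      show "sorted_wrt (<) (u @ Unb n # v)" by (rule rep(1))
      show "kn_le (set (u @ Unb n # v)) E" if "kn_le ?D E" for E using that by (rule raise(2))
    qed
  qed
qed

definition weight :: "nat \<Rightarrow> cletter tableau \<Rightarrow> nat" where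
  "weight n T = sum_list (map (rank n) (concat T))"

lemma raise_tableau:
  assumes T: "T \<in> KN n \<mu>" and i: "1 \<le> i" "i \<le> n"
    and eps: "eps (signature (mark_C n i) T) > 0"
  obtains T' where "T' \<in> KN n \<mu>" "f_C n i T' = Some T" "weight n T' < weight n T"
proof -
  let ?mark = "mark_C n i"
  obtain pre u x v post where split: "T = pre @ (u @ x # v) # post" "?mark x = Some Minus"
    "phi (List.map_filter ?mark (concat (rev post) @ u)) = 0"
    "eps (List.map_filter ?mark (v @ concat (rev pre))) = 0"
    by (rule signature_split[OF eps])
  have cols: "\<forall>C\<in>set T. sorted_wrt (<) C \<and> set C \<subseteq> calphabet n \<and> (\<forall>j. slack (set C) j \<le> 0)"
    and succ: "successively kn_le (map set T)" and shape: "has_shape \<mu> T"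
    using T unfolding KN_iff by auto
  have D: "sorted_wrt (<) (u @ x # v)" "set (u @ x # v) \<subseteq> calphabet n"
    "\<And>j. slack (set (u @ x # v)) j \<le> 0"
    using cols split(1) by auto
  have u: "phi (List.map_filter ?mark u) = 0"
    using split(3) by (simp add: map_filter_append phi_append)
  have v: "eps (List.map_filter ?mark v) = 0"
    using split(4) by (simp add: map_filter_append eps_append)
  show ?thesis
  proof (rule raise_column[OF i D(1,2) split(2) u v D(3)])
    fix y assume y: "?mark y = Some Plus" "move_C n i y = x" "rank n y < rank n x"
      "sorted_wrt (<) (u @ y # v)" "set (u @ y # v) \<subseteq> calphabet n"
      "\<And>j. slack (set (u @ y # v)) j \<le> 0"
      "\<And>E. kn_le (set (u @ x # v)) E \<Longrightarrow> kn_le (set (u @ y # v)) E"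
      "\<And>C. sorted_wrt (<) C \<Longrightarrow> set C \<subseteq> calphabet n \<Longrightarrow>
        eps (List.map_filter ?mark C) \<le> phi (List.map_filter ?mark v) \<Longrightarrow>
        kn_le (set C) (set (u @ x # v)) \<Longrightarrow> kn_le (set C) (set (u @ y # v))"
    let ?T' = "pre @ (u @ y # v) # post"
    have left: "kn_le (set (last pre)) (set (u @ y # v))" if "pre \<noteq> []"
    proof (rule y(8))
      show "sorted_wrt (<) (last pre)" "set (last pre) \<subseteq> calphabet n"
        using cols split(1) that by auto
      show "kn_le (set (last pre)) (set (u @ x # v))"
        using succ split(1) that by (simp add: successively_append_iff last_map)
      \<comment> \<open>The last column of \<open>pre\<close> is read directly after
        \<open>v\<close>, so its surviving Minus letters can only be cancelled by the surviving Plus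
        letters of \<open>v\<close>.\<close>
      have "\<exists>w. concat (rev pre) = last pre @ w"
        using that by (cases pre rule: rev_cases) auto
      then show "eps (List.map_filter ?mark (last pre)) \<le> phi (List.map_filter ?mark v)"
        using split(4) by (auto simp: map_filter_append eps_append)
    qed
    have right: "kn_le (set (u @ y # v)) (set (hd post))" if "post \<noteq> []"
      using succ split(1) that by (intro y(7)) (auto simp: successively_append_iff successively_Cons hd_map)
    have "successively kn_le (map set ?T')"
      using succ left right split(1)
      by (cases "pre = []"; cases "post = []")
        (auto simp: successively_append_iff successively_Cons last_map hd_map)
    moreover have "has_shape \<mu> ?T'" using shape split(1) by (simp add: has_shape_def)
    ultimately have "?T' \<in> KN n \<mu>"
      unfolding KN_iff using cols split(1) y(4-6) by auto
    moreover have "f_C n i ?T' = Some T"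
      unfolding f_C_def split(1) by (rule crystal_op_split) (use y split in auto)
    moreover have "weight n ?T' < weight n T"
      using y(3) by (simp add: weight_def split(1))
    ultimately show thesis by (rule that)
  qed
qed

section \<open>Connectedness\<close>

lemma column_eq:
  assumes "sorted_wrt (<) D" "set D = Unb ` {1..<r}"
  shows "D = map Unb [1..<Suc (length D)]"
proof -
  have eq: "D = map Unb [1..<r]"
    by (rule strict_sorted_equal) (use assms in \<open>auto simp: sorted_wrt_map\<close>)
  have len: "length D = r - 1" using arg_cong[OF eq, of length] by simp
  have "[1..<r] = [1..<Suc (r - 1)]" by (cases r) (simp_all del: upt_Suc)
  with eq show ?thesis unfolding len by (simp only:)
qed

text \<open>In the rightmost column D not of the form 1, ..., h, let r be the least missing unbarred
  letter and x the first letter outside 1, ..., r - 1. Everything read before x is unbarred and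
  below r, while x is a Minus for some i \<ge> r, for which those letters are unmarked. So this
  Minus opens the signature and survives.\<close>

lemma highest_weight_unique:
  assumes T: "T \<in> KN n \<mu>" and eps: "\<And>i. 1 \<le> i \<Longrightarrow> i \<le> n \<Longrightarrow> eps (signature (mark_C n i) T) = 0"
  shows "T = K_C \<mu>"
proof -
  have cols: "\<forall>C\<in>set T. sorted_wrt (<) C \<and> set C \<subseteq> calphabet n \<and> (\<forall>j. slack (set C) j \<le> 0)"
    and succ: "successively kn_le (map set T)" and shape: "has_shape \<mu> T"
    using T unfolding KN_iff by auto
  have "C = map Unb [1..<Suc (length C)]" if "C \<in> set T" for C
  proof (rule ccontr)
    assume "C \<noteq> map Unb [1..<Suc (length C)]"
    with that have ex: "\<exists>D\<in>set T. D \<noteq> map Unb [1..<Suc (length D)]" by blast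
    obtain pre D post where split: "T = pre @ D # post" "D \<noteq> map Unb [1..<Suc (length D)]"
      "\<forall>E\<in>set post. E = map Unb [1..<Suc (length E)]"
      using split_list_last_prop[OF ex] by blast
    have D: "sorted_wrt (<) D" "set D \<subseteq> calphabet n" "\<And>j. slack (set D) j \<le> 0"
      using cols split(1) by auto
    define r where "r = (LEAST r. 1 \<le> r \<and> Unb r \<notin> set D)"
    have "1 \<le> Suc n \<and> Unb (Suc n) \<notin> set D" using D(2) by (auto simp: calphabet_def)
    from LeastI[where P = "\<lambda>r. 1 \<le> r \<and> Unb r \<notin> set D", OF this]
    have r: "1 \<le> r" "Unb r \<notin> set D" unfolding r_def by auto
    have below: "Unb x \<in> set D" if "1 \<le> x" "x < r" for x
      using not_less_Least[of x "\<lambda>r. 1 \<le> r \<and> Unb r \<notin> set D"] that unfolding r_def by auto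
    have ucount: "ucount (set D) k = int k" if "k < r" for k
      using that by (induction k) (auto simp: below)
    have "set D - Unb ` {1..<r} \<noteq> {}"
    proof
      assume "set D - Unb ` {1..<r} = {}"
      then have "set D = Unb ` {1..<r}" using below by auto
      from column_eq[OF D(1) this] split(2) show False by contradiction
    qed
    define x where "x = Min (set D - Unb ` {1..<r})"
    have fin: "finite (set D - Unb ` {1..<r})" by simp
    from Min_in[OF fin \<open>set D - Unb ` {1..<r} \<noteq> {}\<close>]
    have x: "x \<in> set D" "x \<notin> Unb ` {1..<r}" unfolding x_def by blast+
    have x_le: "w \<in> Unb ` {1..<r}" if "w \<in> set D" "w < x" for w
      using Min_le[OF fin, of w, folded x_def] that leD by blast
    obtain i where i: "r \<le> i" "i \<le> n" "mark_C n i x = Some Minus"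
    proof (cases x)
      case (Unb a)
      then have a: "1 \<le> a" "a \<le> n" using x(1) D(2) by (auto simp: calphabet_def)
      moreover have "\<not> a < r" using x(2) Unb a by auto
      moreover have "a \<noteq> r" using x(1) r(2) Unb by auto
      ultimately have "1 \<le> a" "a \<le> n" "r < a" by auto
      then show ?thesis
        using Unb by (intro that[of "a - 1"]) (auto simp: mark_C_def)
    next
      case (Bar a)
      then have a: "1 \<le> a" "a \<le> n" using x D(2) by (auto simp: calphabet_def)
      \<comment> \<open>Otherwise D contains 1, ..., a and \<open>Bar a\<close>, and its slack at a
        is positive.\<close>
      have "r \<le> a"
      proof (rule ccontr)
        assume "\<not> r \<le> a"
        then have "ucount (set D) a = int a" using ucount by simp
        moreover have "0 \<le> bcount (set D) (a - 1)" by (simp add: bcount_def cnt_eq_card)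
        then have "1 \<le> bcount (set D) a"
          using a(1) x(1) Bar by (cases a) auto
        ultimately show False using D(3)[of a] by (simp add: slack_def)
      qed
      then show ?thesis using Bar a by (intro that[of a]) (auto simp: mark_C_def)
    qed
    obtain u v where uv: "D = u @ x # v" using x(1) by (meson split_list)
    have u: "w \<in> Unb ` {1..<r}" if "w \<in> set u" for w
      using D(1) that x_le unfolding uv by (auto simp: sorted_wrt_append)
    have post: "w \<in> Unb ` {1..<r}" if E: "E \<in> set post" "w \<in> set E" for E w
    proof -
      \<comment> \<open>\<open>ucount\<close> at r weakly decreases from left to right and is below
        r for D, which lacks r; so a column 1, ..., h to the right of D has h < r.\<close>
      let ?le = "\<lambda>S S'. ucount S' r \<le> ucount S r"
      have "successively ?le (map set T)"
        by (rule successively_mono[OF succ]) (rule kn_le_counts(1))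
      moreover have "transp ?le" by (auto simp: transp_def)
      ultimately have "sorted_wrt ?le (map set T)"
        by (simp add: successively_conv_sorted_wrt)
      then have "ucount (set E) r \<le> ucount (set D) r"
        using E(1) split(1) by (auto simp: sorted_wrt_append)
      also have "\<dots> < int r" using r ucount[of "r - 1"] by (cases r) auto
      finally have lt: "ucount (set E) r < int r" .
      have E': "set E = Unb ` {1..<Suc (length E)}"
        using arg_cong[OF split(3)[rule_format, OF E(1)], of set]
        by (simp only: set_map atLeastLessThan_upt)
      have "length E < r"
      proof (rule ccontr)
        assume "\<not> length E < r"
        then have "ucount (set E) k = int k" if "k \<le> r" for k
          using that unfolding E' by (induction k) auto
        then show False using lt by simp
      qed
      then show ?thesis using E(2) unfolding E' by auto
    qed
    have no_marks: "List.map_filter (mark_C n i) w = []" if "set w \<subseteq> Unb ` {1..<r}" for w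
    proof -
      have "mark_C n i y = None" if "y \<in> set w" for y
      proof -
        have "y \<in> Unb ` {1..<r}" using that \<open>set w \<subseteq> Unb ` {1..<r}\<close> by blast
        then obtain a where "y = Unb a" "a < r" by auto
        then show ?thesis using i(1) by (simp add: mark_C_def)
      qed
      then show ?thesis by (induction w) auto
    qed
    have prefix: "List.map_filter (mark_C n i) (concat (rev post) @ u) = []"
    proof (rule no_marks)
      show "set (concat (rev post) @ u) \<subseteq> Unb ` {1..<r}"
        unfolding set_append set_concat set_rev using u post by blast
    qed
    have "signature (mark_C n i) T = List.map_filter (mark_C n i)
        ((concat (rev post) @ u) @ [x] @ v @ concat (rev pre))"
      by (simp add: split(1) uv)
    also have "\<dots> = Minus # List.map_filter (mark_C n i) (v @ concat (rev pre))"
      unfolding map_filter_append[of _ "concat (rev post) @ u"] prefix using i(3)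
      by simp
    finally show False using eps[of i] i r by simp
  qed
  then have "T = map (\<lambda>D. map Unb [1..<Suc (length D)]) T"
    by (intro map_idI[symmetric]) (rule sym)
  also have "\<dots> = map (\<lambda>h. map Unb [1..<Suc h]) (map length T)"
    by (simp only: map_map o_def)
  also have "\<dots> = K_C \<mu>"
    using shape by (simp only: has_shape_def K_C_def K_A_def map_map o_def)
  finally show ?thesis .
qed

lemma KN_reachable:
  assumes "T \<in> KN n \<mu>"
  shows "\<exists>ps. set ps \<subseteq> {1..n} \<and> apply_path (f_C n) ps (K_C \<mu>) = Some T"
  using assms
proof (induction "weight n T" arbitrary: T rule: less_induct)
  case less
  show ?case
  proof (cases "T = K_C \<mu>")
    case True
    then show ?thesis by (intro exI[of _ "[]"]) (simp add: apply_path_def)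
  next
    case False
    then obtain i where i: "1 \<le> i" "i \<le> n" "eps (signature (mark_C n i) T) > 0"
      using highest_weight_unique[OF less.prems] by (metis gr0I)
    obtain T' where T': "T' \<in> KN n \<mu>" "f_C n i T' = Some T" "weight n T' < weight n T"
      using raise_tableau[OF less.prems i] .
    obtain ps where "set ps \<subseteq> {1..n}" "apply_path (f_C n) ps (K_C \<mu>) = Some T'"
      using less.hyps[OF T'(3,1)] by blast
    then show ?thesis using i T'(2)
      by (intro exI[of _ "i # ps"]) (auto simp: apply_path_def)
  qed
qed

section \<open>Commuting operators and paths\<close>

text \<open>Separates the cell where \<open>crystal_op\<close> acts from what it writes there: two
  operators commute once neither shifts the cell of the other.\<close>

definition first_plus :: "('a \<Rightarrow> sign option) \<Rightarrow> 'a tableau \<Rightarrow> (nat \<times> nat) option" where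
  "first_plus mark T =
     (case filter (\<lambda>x. fst x = Plus) (cancel (marked_cells mark T)) of
        [] \<Rightarrow> None | x # _ \<Rightarrow> Some (snd x))"

definition update_cell :: "('a \<Rightarrow> 'a) \<Rightarrow> 'a tableau \<Rightarrow> nat \<times> nat \<Rightarrow> 'a tableau" where
  "update_cell move T = (\<lambda>(j, r). T[j := (T ! j)[r := move (T ! j ! r)]])"

lemma crystal_op_eq:
  "crystal_op mark move T = map_option (update_cell move T) (first_plus mark T)"
  unfolding crystal_op_def first_plus_def update_cell_def
  by (auto split: list.split)

lemma set_cancel: "set (cancel w) \<subseteq> set w"
  by (induction w) (auto split: list.splits if_splits)

lemma first_plus_SomeD:
  assumes "first_plus mark T = Some (j, r)"
  shows "j < length T" "r < length (T ! j)" "mark (T ! j ! r) = Some Plus"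
proof -
  obtain x ys where x: "filter (\<lambda>x. fst x = Plus) (cancel (marked_cells mark T)) = x # ys"
    and "snd x = (j, r)"
    using assms unfolding first_plus_def by (auto split: list.splits)
  have "set (x # ys) \<subseteq> {x \<in> set (marked_cells mark T). fst x = Plus}"
    unfolding x[symmetric] using set_cancel[of "marked_cells mark T"] by auto
  then have "(Plus, j, r) \<in> set (marked_cells mark T)"
    using \<open>snd x = (j, r)\<close> by (cases x) auto
  then show "j < length T" "r < length (T ! j)" "mark (T ! j ! r) = Some Plus"
    unfolding marked_cells_def reading_cells_def List.map_filter_def by auto
qed

lemma first_plus_update:
  assumes "j < length T" "r < length (T ! j)" "mark (T ! j ! r) = None"
    "mark (move (T ! j ! r)) = None"
  shows "first_plus mark (update_cell move T (j, r)) = first_plus mark T"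
proof -
  define T' where "T' = update_cell move T (j, r)"
  have len: "length T' = length T" "length (T' ! j') = length (T ! j')" for j'
    using assms(1) by (cases "j' = j"; simp add: T'_def update_cell_def)+
  have cell: "mark (T' ! j' ! r') = mark (T ! j' ! r')" for j' r'
    using assms
    by (cases "j' = j"; cases "r' = r") (auto simp: T'_def update_cell_def)
  have "marked_cells mark T' = marked_cells mark T"
    unfolding marked_cells_def reading_cells_def len cell ..
  then show ?thesis by (simp add: first_plus_def T'_def)
qed

lemma update_cell_commute:
  assumes "j < length T" "k < length T" "(j, r) \<noteq> (k, s)"
  shows "update_cell f (update_cell g T (k, s)) (j, r) = update_cell g (update_cell f T (j, r)) (k, s)"
  using assms by (cases "j = k") (auto simp: update_cell_def list_update_swap)

text \<open>A letter moved by one operator is unmarked for the other before and after the move, so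
  the signatures do not interact; the two cells differ because no letter is a Plus for both.\<close>

lemma crystal_op_commute:
  assumes "\<And>x. mark x = Some Plus \<Longrightarrow> mark' x = None \<and> mark' (move x) = None"
    "\<And>x. mark' x = Some Plus \<Longrightarrow> mark x = None \<and> mark (move' x) = None"
  shows "Option.bind (crystal_op mark move T) (crystal_op mark' move') =
    Option.bind (crystal_op mark' move' T) (crystal_op mark move)"
proof -
  have 1: "first_plus mark' (update_cell move T p) = first_plus mark' T"
    if "first_plus mark T = Some p" for p
    using first_plus_SomeD[of mark T "fst p" "snd p"] assms(1) that
      first_plus_update[of "fst p" T "snd p" mark' move] by simp
  have 2: "first_plus mark (update_cell move' T p) = first_plus mark T"
    if "first_plus mark' T = Some p" for p
    using first_plus_SomeD[of mark' T "fst p" "snd p"] assms(2) that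
      first_plus_update[of "fst p" T "snd p" mark move'] by simp
  show ?thesis
  proof (cases "first_plus mark T")
    case None
    then show ?thesis using 2 by (cases "first_plus mark' T") (auto simp: crystal_op_eq)
  next
    case (Some p)
    obtain j r where p: "p = (j, r)" by (cases p)
    note Tp = first_plus_SomeD[OF Some[unfolded p]]
    show ?thesis
    proof (cases "first_plus mark' T")
      case None
      then show ?thesis using 1[OF Some] Some by (simp add: crystal_op_eq)
    next
      case (Some q)
      obtain k s where q: "q = (k, s)" by (cases q)
      note Tq = first_plus_SomeD[OF Some[unfolded q]]
      have "(k, s) \<noteq> (j, r)"
        using Tp(3) Tq(3) assms(1)[OF Tp(3)] by auto
      from update_cell_commute[OF Tq(1) Tp(1) this, of move' move]
      have "update_cell move' (update_cell move T p) q = update_cell move (update_cell move' T q) p"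
        unfolding p q .
      then show ?thesis
        using 1[OF \<open>first_plus mark T = Some p\<close>] 2[OF Some] Some \<open>first_plus mark T = Some p\<close>
        by (simp add: crystal_op_eq)
    qed
  qed
qed

lemma f_A_commute:
  assumes "Suc i < j"
  shows "Option.bind (f_A i T) (f_A j) = Option.bind (f_A j T) (f_A i)"
  unfolding f_A_def
  by (rule crystal_op_commute) (use assms in \<open>auto simp: mark_A_def split: if_splits\<close>)

section \<open>Words in the operators\<close>

lemma apply_path_simps [simp]:
  "apply_path f [] x = Some x"
  "apply_path f (i # ps) x = Option.bind (apply_path f ps x) (f i)"
  by (simp_all add: apply_path_def)

lemma apply_path_append:
  "apply_path f (ps @ qs) x = Option.bind (apply_path f qs x) (apply_path f ps)"
proof (induction ps)
  case Nil
  then show ?case by (cases "apply_path f qs x") auto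
next
  case (Cons i ps)
  then show ?case by (cases "apply_path f qs x") auto
qed

lemma op_power_eq: "op_power f m i = apply_path f (replicate m i)"
proof
  fix x show "op_power f m i x = apply_path f (replicate m i) x"
    by (induction m) (auto simp: op_power_def)
qed

text \<open>Substitution of words for letters. It turns a path in \<open>f_E\<close> into one in
  \<open>f_A\<close>, and a path in m-th powers into an ordinary path.\<close>

lemma apply_path_concat:
  "apply_path f (concat (map g ps)) x = apply_path (\<lambda>i. apply_path f (g i)) ps x"
  by (induction ps) (auto simp: apply_path_append)

lemma apply_path_replicate_commute:
  assumes "\<And>x. Option.bind (f i x) (f j) = Option.bind (f j x) (f i)"
  shows "Option.bind (apply_path f (replicate m i) x) (f j) =
    Option.bind (f j x) (apply_path f (replicate m i))"
proof (induction m)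
  case 0
  then show ?case by (cases "f j x") auto
next
  case (Suc m)
  let ?g = "apply_path f (replicate m i)"
  have "Option.bind (Option.bind (?g x) (f i)) (f j) = Option.bind (Option.bind (?g x) (f j)) (f i)"
    by (cases "?g x") (auto intro: assms)
  also have "\<dots> = Option.bind (Option.bind (f j x) ?g) (f i)"
    by (simp only: Suc.IH)
  finally show ?case by (cases "f j x") auto
qed

lemma apply_path_replicate_pair:
  assumes "\<And>x. Option.bind (f i x) (f j) = Option.bind (f j x) (f i)"
  shows "apply_path f (concat (replicate m [i, j])) x =
    apply_path f (replicate m i @ replicate m j) x"
proof (induction m)
  case (Suc m)
  let ?g = "apply_path f (replicate m i)" and ?h = "apply_path f (replicate m j)"
  have "apply_path f (concat (replicate (Suc m) [i, j])) x =
      Option.bind (Option.bind (Option.bind (?h x) ?g) (f j)) (f i)"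
    using Suc.IH by (simp add: apply_path_append)
  also have "Option.bind (Option.bind (?h x) ?g) (f j) = Option.bind (Option.bind (?h x) (f j)) ?g"
    using apply_path_replicate_commute[of f i j, OF assms] by (cases "?h x") auto
  finally show ?case by (cases "?h x") (auto simp: apply_path_append)
qed simp

text \<open>The word of \<open>f_E\<close> over \<open>f_A\<close>. Indices above n get the word of
  n, matching the else branch of \<open>f_E\<close>, so that \<open>f_E_eq\<close> is an equation of
  functions.\<close>

definition type_A_path :: "nat \<Rightarrow> nat \<Rightarrow> nat list" where
  "type_A_path n i = (if i < n then [i, 2 * n - i] else [n, n])"

lemma f_E_eq: "f_E n = (\<lambda>i. apply_path f_A (type_A_path n i))"
  by (intro ext) (auto simp: f_E_def type_A_path_def)

text \<open>The commutation at the heart of the theorem: repeating the word of \<open>f_E\<close> m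
  times equals replacing each of its letters by an m-th power.\<close>

lemma f_E_power:
  "apply_path (f_E n) (replicate m i) = apply_path (op_power f_A m) (type_A_path n i)"
proof
  fix x
  have *: "apply_path (f_E n) (replicate m i) x =
      apply_path f_A (concat (replicate m (type_A_path n i))) x"
    using apply_path_concat[of f_A "type_A_path n" "replicate m i" x]
    by (simp add: f_E_eq)
  show "apply_path (f_E n) (replicate m i) x = apply_path (op_power f_A m) (type_A_path n i) x"
  proof (cases "i < n")
    case True
    \<comment> \<open>For i < n one has 2n - i \<ge> n + 1 > i + 1, so the two operators act on
      disjoint pairs of letters.\<close>
    have "apply_path f_A (concat (replicate m [i, 2 * n - i])) x =
        apply_path f_A (replicate m i @ replicate m (2 * n - i)) x"
      by (rule apply_path_replicate_pair, rule f_A_commute) (use True in linarith)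
    then show ?thesis
      unfolding * using True by (simp add: type_A_path_def op_power_eq apply_path_append)
  next
    case False
    have "concat (replicate m [n, n]) = replicate m n @ replicate m n"
      by (induction m) (auto simp: replicate_app_Cons_same)
    then show ?thesis
      unfolding * using False by (simp add: type_A_path_def op_power_eq apply_path_append)
  qed
qed

section \<open>Shapes\<close>

lemma sum_list_col_heights:
  "(\<Sum>h\<leftarrow>col_heights \<mu>. g h) =
   (\<Sum>j<Max (insert 0 (set \<mu>)). g (length (filter (\<lambda>p. j < p) \<mu>)))"
  by (simp add: col_heights_def sum_list_distinct_conv_sum_set atLeast0LessThan)

text \<open>Scaling the rows repeats each column m times: column j of the scaled shape is as tall as
  column j div m of the original.\<close>

lemma sum_list_col_heights_scale:
  assumes "m \<ge> 1"
  shows "(\<Sum>h\<leftarrow>col_heights (scale_partition m \<mu>). g h) = m * (\<Sum>h\<leftarrow>col_heights \<mu>. g h :: nat)"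
proof -
  define M where "M = Max (insert 0 (set \<mu>))"
  define G where "G = (\<lambda>j. g (length (filter (\<lambda>p. j < p) \<mu>)))"
  have "mono (\<lambda>p::nat. m * p)" by (auto simp: mono_def)
  from mono_Max_commute[OF this, of "insert 0 (set \<mu>)"]
  have M: "Max (insert 0 (set (scale_partition m \<mu>))) = m * M"
    by (simp add: scale_partition_def M_def)
  have G: "length (filter (\<lambda>p. j < p) (scale_partition m \<mu>)) =
      length (filter (\<lambda>p. j div m < p) \<mu>)" for j
  proof -
    have "j < m * p \<longleftrightarrow> j div m < p" for p
      using assms div_less_iff_less_mult[of m j p] by (simp add: mult.commute)
    then show ?thesis by (simp add: scale_partition_def filter_map o_def)
  qed
  have "(\<Sum>h\<leftarrow>col_heights (scale_partition m \<mu>). g h) = (\<Sum>j<M * m. G (j div m))"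
    unfolding sum_list_col_heights M G G_def mult.commute[of m] ..
  also have "\<dots> = (\<Sum>k<M. \<Sum>j=k * m..<k * m + m. G (j div m))"
    by (rule sum.nat_group[symmetric])
  also have "\<dots> = (\<Sum>k<M. m * G k)"
  proof (rule sum.cong)
    fix k
    have "j div m = k" if "j \<in> {k * m..<k * m + m}" for j
      using that by (intro div_nat_eqI) (auto simp: mult.commute)
    then show "(\<Sum>j=k * m..<k * m + m. G (j div m)) = m * G k" by simp
  qed simp
  also have "\<dots> = m * (\<Sum>h\<leftarrow>col_heights \<mu>. g h)"
    by (simp add: sum_list_col_heights M_def G_def sum_distrib_left)
  finally show ?thesis .
qed

lemma shape_A_scale:
  "m \<ge> 1 \<Longrightarrow> shape_A n (scale_partition m \<mu>) = scale_partition m (shape_A n \<mu>)"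
  by (simp add: shape_A_def sum_list_col_heights_scale) (simp add: scale_partition_def)

theorem proposition7p9:
  fixes n m :: nat and \<mu> :: "nat list"
    and E E' :: "cletter tableau \<Rightarrow> nat tableau"
    and \<theta>\<^sub>A :: "nat tableau \<Rightarrow> nat tableau"
    and \<theta>\<^sub>C :: "cletter tableau \<Rightarrow> cletter tableau"
  assumes "1 \<le> n" and "1 \<le> m" and "is_partition n \<mu>"
    and "is_baker_embedding n \<mu> E"
    and "is_dilatation_A n m (shape_A n \<mu>) \<theta>\<^sub>A"
    and "is_dilatation_C n m \<mu> \<theta>\<^sub>C"
    and "is_baker_embedding n (scale_partition m \<mu>) E'"
  shows "\<forall>T \<in> KN n \<mu>.
           \<theta>\<^sub>A (E T) \<in> SSYT (2 * n) (scale_partition m (shape_A n \<mu>)) \<and>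
           \<theta>\<^sub>A (E T) = E' (\<theta>\<^sub>C T)"
proof (intro ballI conjI)
  fix T assume T: "T \<in> KN n \<mu>"
  show "\<theta>\<^sub>A (E T) \<in> SSYT (2 * n) (scale_partition m (shape_A n \<mu>))"
    using T assms(4,5)
    unfolding is_baker_embedding_def is_dilatation_A_def is_dilatation_def by blast
  obtain ps where ps: "set ps \<subseteq> {1..n}" "apply_path (f_C n) ps (K_C \<mu>) = Some T"
    using KN_reachable[OF T] by blast
  \<comment> \<open>\<open>?qs\<close> spells the path out in type A operators, where the dilatation
    of \<open>E T\<close> is prescribed; \<open>?rs\<close> repeats each index m times, making the
    m-th powers an ordinary path on which \<open>E'\<close> is prescribed.\<close>
  let ?qs = "concat (map (type_A_path n) ps)" and ?rs = "concat (map (replicate m) ps)"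
  let ?K = "K_A (scale_partition m (shape_A n \<mu>))"
  have "apply_path f_A ?qs (K_A (shape_A n \<mu>)) = Some (E T)"
    using ps assms(4) unfolding is_baker_embedding_def f_E_eq apply_path_concat by blast
  moreover have "set ?qs \<subseteq> {1..<2 * n}"
    using ps(1) by (auto simp: type_A_path_def split: if_splits)
  ultimately have "apply_path (op_power f_A m) ?qs ?K = Some (\<theta>\<^sub>A (E T))"
    using assms(5) unfolding is_dilatation_A_def is_dilatation_def by blast
  then have A: "apply_path (\<lambda>i. apply_path (op_power f_A m) (type_A_path n i)) ps ?K =
      Some (\<theta>\<^sub>A (E T))"
    unfolding apply_path_concat .
  have "apply_path (op_power (f_C n) m) ps (K_C (scale_partition m \<mu>)) = Some (\<theta>\<^sub>C T)"
    using ps assms(6) unfolding is_dilatation_C_def is_dilatation_def by blast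
  then have "apply_path (f_C n) ?rs (K_C (scale_partition m \<mu>)) = Some (\<theta>\<^sub>C T)"
    unfolding apply_path_concat op_power_eq[abs_def] .
  moreover have "set ?rs \<subseteq> {1..n}" using ps(1) by auto
  ultimately have "apply_path (f_E n) ?rs ?K = Some (E' (\<theta>\<^sub>C T))"
    using assms(7) shape_A_scale[OF assms(2)] unfolding is_baker_embedding_def by metis
  then have "apply_path (\<lambda>i. apply_path (op_power f_A m) (type_A_path n i)) ps ?K =
      Some (E' (\<theta>\<^sub>C T))"
    unfolding apply_path_concat f_E_power .
  with A show "\<theta>\<^sub>A (E T) = E' (\<theta>\<^sub>C T)" by simp
qed

end
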